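(* For every $t\in O(\log n)$ (i.e. every $t=t(n)\ge 1$ with $t(n)=O(\log n)$), we have $$\mathsf{size\text{-}pls}(\mathrm{MST},t)=O\left(\frac{\log^2 n}{t}\right),$$ where $n$ is the number of nodes.
   Context: Predicate. Consider connected undirected weighted labeled graphs $(G,x)$ in which each label $x(v)$ contains a (possibly empty) subset of the edges incident to $v$, consistently between neighbors (an edge $\{u,v\}$ is in $x(u)$ iff it is in $x(v)$). Let $T_x$ be the set of all edges represented in $x$. The predicate $\mathrm{MST}$ holds on $(G,x)$ iff $T_x$ is a spanning tree of $G$ whose sum of edge weights is minimum among all spanning trees of $G$. Edge weights of $n$-node graphs are in $[1,n^c]$ for a fixed $c\ge1$, encodable on $O(\log n)$ bits. Model. An identity assignment on a graph $G=(V,E)$ (finite, connected, simple) is an injective map $\mathrm{ID}:V\to[1,n^c]$ for some fixed $c\ge 1$, where $n=|V|$. A proof-labeling scheme (PLS) for a predicate $\mathcal{P}$ is a pair $(\mathbf{p},\mathbf{v})$, where the prover $\mathbf{p}$ assigns to every node $v$ of every instance $(G,x,\mathrm{ID})$ a bit-string called certificate, and the verifier $\mathbf{v}$ is a deterministic distributed algorithm in the LOCAL model in which every node outputs accept or reject, such that: (i) if $(G,x,\mathrm{ID})$ satisfies $\mathcal{P}$, then all nodes accept with the certificates given by $\mathbf{p}$; (ii) if $(G,x,\mathrm{ID})$ does not satisfy $\mathcal{P}$, then for every assignment of certificates to the nodes, at least one node rejects. The radius of the scheme is the maximum number of rounds of $\mathbf{v}$; a scheme of radius $t$ is one where, equivalently,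 each node $v$ decides from $t$, the structure of the ball of radius $t$ (in hops) around $v$, and the identities, labels, incident edge weights and certificates of the nodes at distance at most $t$ from $v$ (arbitrary local computation is allowed). The size of a scheme, as a function of $n$, is the maximum number of bits of a certificate assigned by $\mathbf{p}$ to a node, over all $n$-node instances satisfying $\mathcal{P}$. $\mathsf{size\text{-}pls}(\mathcal{P},t)$ is the minimum size of a PLS for $\mathcal{P}$ of radius at most $t$ on $n$-node labeled graphs. *)

theory Defs
  imports
    Complex_Main
    "HOL-Library.Multiset"
    "HOL-Library.Extended_Nat"
    "HOL-Library.Landau_Symbols"
begin

text \<open>Undirected simple graphs: an edge is a two-element set of nodes.\<close>

definition simple_graph :: "nat set \<Rightarrow> nat set set \<Rightarrow> bool" where
  "simple_graph V E \<longleftrightarrow> finite V \<and> V \<noteq> {} \<and> (\<forall>e\<in>E. e \<subseteq> V \<and> card e = 2)"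

definition adj :: "nat set set \<Rightarrow> (nat \<times> nat) set" where
  "adj E = {(u, v). {u, v} \<in> E}"

definition connected_graph :: "nat set \<Rightarrow> nat set set \<Rightarrow> bool" where
  "connected_graph V E \<longleftrightarrow> (\<forall>u\<in>V. \<forall>v\<in>V. (u, v) \<in> (adj E)\<^sup>*)"

definition cycle :: "nat set set \<Rightarrow> nat list \<Rightarrow> bool" where
  "cycle E p \<longleftrightarrow> 3 \<le> length p \<and> distinct p \<and>
     (\<forall>i<length p. {p ! i, p ! (Suc i mod length p)} \<in> E)"

definition spanning_tree :: "nat set \<Rightarrow> nat set set \<Rightarrow> nat set set \<Rightarrow> bool" where
  "spanning_tree V E T \<longleftrightarrow> T \<subseteq> E \<and> connected_graph V T \<and> (\<nexists>p. cycle T p)"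

definition ball :: "nat set set \<Rightarrow> nat \<Rightarrow> nat \<Rightarrow> nat set" where
  "ball E r v = {u. \<exists>k\<le>r. (v, u) \<in> adj E ^^ k}"

text \<open>
  Nodes are taken from \<^typ>\<open>nat\<close> without loss of generality: names of nodes are not
  visible to verifiers, which only see the identities \<open>ident\<close>.
\<close>

record config =
  verts :: "nat set"
  edges :: "nat set set"
  wt :: "nat set \<Rightarrow> nat"
  lab :: "nat \<Rightarrow> nat set set"
  ident :: "nat \<Rightarrow> nat"

definition incident :: "config \<Rightarrow> nat \<Rightarrow> nat set set" where
  "incident G v = {e \<in> edges G. v \<in> e}"

definition represented :: "config \<Rightarrow> nat set set" where
  "represented G = (\<Union>v\<in>verts G. lab G v)"

text \<open>
  Admissible instances: on \<open>n\<close> nodes, weights lie in \<open>[1, n\<^sup>c]\<close> and identities in \<open>[1, n\<^sup>d]\<close>.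
\<close>

definition admissible :: "real \<Rightarrow> real \<Rightarrow> config \<Rightarrow> bool" where
  "admissible c d G \<longleftrightarrow>
     simple_graph (verts G) (edges G) \<and>
     connected_graph (verts G) (edges G) \<and>
     (\<forall>e\<in>edges G. 1 \<le> wt G e \<and> real (wt G e) \<le> real (card (verts G)) powr c) \<and>
     (\<forall>v\<in>verts G. lab G v \<subseteq> incident G v) \<and>
     (\<forall>u v. {u, v} \<in> edges G \<longrightarrow> ({u, v} \<in> lab G u \<longleftrightarrow> {u, v} \<in> lab G v)) \<and>
     inj_on (ident G) (verts G) \<and>
     (\<forall>v\<in>verts G. 1 \<le> ident G v \<and> real (ident G v) \<le> real (card (verts G)) powr d)"

definition MST :: "config \<Rightarrow> bool" where
  "MST G \<longleftrightarrow> spanning_tree (verts G) (edges G) (represented G) \<and>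
     (\<forall>T. spanning_tree (verts G) (edges G) T \<longrightarrow> sum (wt G) (represented G) \<le> sum (wt G) T)"

type_synonym certificate = "bool list"

text \<open>
  What a node learns in \<open>r\<close> rounds. \<open>v_edges\<close> is the subgraph induced by the ball, with
  nodes named by their identities; each edge carries its weight and whether it belongs to the
  labels of its endpoints. Each entry of \<open>v_nodes\<close> holds identity, certificate, and weight and
  label membership of all incident edges of a node of the ball. For edges leaving the ball
  these two data are visible, but the endpoint outside the ball is not.
\<close>

record view =
  v_center :: nat
  v_nodes :: "(nat \<times> certificate \<times> (nat \<times> bool) multiset) set"
  v_edges :: "(nat set \<times> nat \<times> bool) set"

definition local_view :: "nat \<Rightarrow> config \<Rightarrow> (nat \<Rightarrow> certificate) \<Rightarrow> nat \<Rightarrow> view" where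
  "local_view r G cert v =
     \<lparr> v_center = ident G v,
       v_nodes = (\<lambda>u. (ident G u, cert u,
                       image_mset (\<lambda>e. (wt G e, e \<in> lab G u)) (mset_set (incident G u))))
                 ` ball (edges G) r v,
       v_edges = (\<lambda>e. (ident G ` e, wt G e, e \<in> represented G))
                 ` {e \<in> edges G. e \<subseteq> ball (edges G) r v} \<rparr>"

type_synonym prover = "config \<Rightarrow> nat \<Rightarrow> certificate"
type_synonym verifier = "nat \<Rightarrow> view \<Rightarrow> bool"

text \<open>
  On \<open>n\<close>-node instances every node decides from the value \<open>t n\<close> and its view of radius \<open>t n\<close>
  (the number \<open>n\<close> itself is not given). As the verifier is free to ignore the outer part of
  the view, this covers all radii up to \<open>t n\<close>.
\<close>

definition accepts ::
    "(nat \<Rightarrow> nat) \<Rightarrow> verifier \<Rightarrow> config \<Rightarrow> (nat \<Rightarrow> certificate) \<Rightarrow> nat \<Rightarrow> bool" where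
  "accepts t ver G cert v \<longleftrightarrow>
     (let r = t (card (verts G)) in ver r (local_view r G cert v))"

definition is_pls ::
    "real \<Rightarrow> real \<Rightarrow> (config \<Rightarrow> bool) \<Rightarrow> (nat \<Rightarrow> nat) \<Rightarrow> prover \<times> verifier \<Rightarrow> bool" where
  "is_pls c d P t = (\<lambda>(prv, ver). \<forall>G. admissible c d G \<longrightarrow>
     (P G \<longrightarrow> (\<forall>v\<in>verts G. accepts t ver G (prv G) v)) \<and>
     (\<not> P G \<longrightarrow> (\<forall>cert. \<exists>v\<in>verts G. \<not> accepts t ver G cert v)))"

definition scheme_size ::
    "real \<Rightarrow> real \<Rightarrow> (config \<Rightarrow> bool) \<Rightarrow> prover \<times> verifier \<Rightarrow> nat \<Rightarrow> enat" where
  "scheme_size c d P S n =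
     (SUP G \<in> {G. admissible c d G \<and> P G \<and> card (verts G) = n}.
        SUP v \<in> verts G. enat (length (fst S G v)))"

text \<open>\<open>\<infinity>\<close> if there is no scheme; otherwise the infimum is attained, as \<^typ>\<open>enat\<close> is well-ordered.\<close>

definition size_pls ::
    "real \<Rightarrow> real \<Rightarrow> (config \<Rightarrow> bool) \<Rightarrow> (nat \<Rightarrow> nat) \<Rightarrow> nat \<Rightarrow> enat" where
  "size_pls c d P t n = (INF S \<in> {S. is_pls c d P t S}. scheme_size c d P S n)"

end

theory Submission
  imports Defs
begin

text \<open>
  A spanning tree \<open>T\<close> is minimum iff the endpoints of every non-tree edge \<open>e\<close> are joined by tree
  edges of weight at most \<open>w(e)\<close>. A vertex ranking of \<open>T\<close> by \<open>log n\<close> levels, obtained from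
  centroids, gives every node at most one centre per level, and any two nodes share a centre on
  the tree path between them. To certify \<open>e\<close> it is therefore enough that each node knows,
  for each of its centres, the bottleneck weight of the path to it: \<open>log n\<close> entries of
  \<open>O(log n)\<close> bits. Given radius \<open>t\<close>, a node keeps only the centres whose level is congruent to its
  depth modulo about \<open>t/2\<close>; the other entries are found at nearby nodes on the path to the
  centre. The root and the depth, which certify that \<open>T\<close> is a spanning tree, cost \<open>O(log n)\<close>
  bits, which is affordable because \<open>t = O(log n)\<close>.
\<close>

section \<open>Shortest walks\<close>

text \<open>Soundness never inspects the ranking: an accepted entry only guarantees a light tree
  walk, and two entries with the same centre then give a light walk between the ends of a non-tree
  edge. The ranking thus needs no certificate of its own; it only helps the prover keep lists short.
  What must be excluded is a circular chain of entries that support each other. The bottleneck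
  weight alone cannot do this, as it may stay constant along a path; hence the second, hop-counting
  number. The depth serves as the selecting residue because one number of the node has to choose
  among all its centres at once, which bounds the list by about (number of levels) / (modulus). The
  price is that depth is not monotone along a tree path: it falls and then rises. Some half of a
  window of 2 s - 1 nodes, middle included, is monotone and has s nodes. The modulus s = (t + 1) div
  2 is the largest for which such a window still fits into radius t after one extra step, taken
  either to make progress or to cross a non-tree edge.\<close>

definition walk_dist :: "('a \<times> 'a) set \<Rightarrow> 'a \<Rightarrow> 'a \<Rightarrow> nat" where
  "walk_dist R u v = (LEAST n. (u, v) \<in> R ^^ n)"

lemma relpow_segment:
  assumes "\<And>i. i < n \<Longrightarrow> (f i, f (Suc i)) \<in> R" "i \<le> j" "j \<le> n"
  shows "(f i, f j) \<in> R ^^ (j - i)"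
  unfolding relpow_fun_conv
  by (rule exI[of _ "\<lambda>k. f (i + k)"]) (use assms in auto)

lemma rtrancl_segment:
  assumes "\<And>k. i \<le> k \<Longrightarrow> k < j \<Longrightarrow> (f k, f (Suc k)) \<in> R" "i \<le> j"
  shows "(f i, f j) \<in> R\<^sup>*"
  using assms(2,1)
proof (induction j rule: dec_induct)
  case (step n)
  then have "(f i, f n) \<in> R\<^sup>*" "(f n, f (Suc n)) \<in> R" by auto
  then show ?case by (rule rtrancl.rtrancl_into_rtrancl)
qed auto

lemma walk_dist_relpow: "(u, v) \<in> R\<^sup>* \<Longrightarrow> (u, v) \<in> R ^^ walk_dist R u v"
  unfolding walk_dist_def by (meson LeastI_ex rtrancl_imp_relpow)

lemma walk_dist_le: "(u, v) \<in> R ^^ n \<Longrightarrow> walk_dist R u v \<le> n"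
  unfolding walk_dist_def by (rule Least_le)

lemma walk_dist_self [simp]: "walk_dist R v v = 0"
  using walk_dist_le[where R = R and n = 0] by force

text \<open>A shortcut from \<open>f i\<close> to \<open>v\<close> would shorten the whole walk, so
  the distance to \<open>v\<close> falls by exactly one per step; distinct distances make
  \<open>f\<close> injective.\<close>

lemma shortest_walk:
  assumes "(u, v) \<in> R\<^sup>*"
  obtains f where "f 0 = u" "f (walk_dist R u v) = v"
    "\<And>i. i < walk_dist R u v \<Longrightarrow> (f i, f (Suc i)) \<in> R"
    "\<And>i. i \<le> walk_dist R u v \<Longrightarrow> walk_dist R (f i) v = walk_dist R u v - i"
    "inj_on f {..walk_dist R u v}"
proof -
  let ?d = "walk_dist R u v"
  obtain f where f: "f 0 = u" "f ?d = v" "\<And>i. i < ?d \<Longrightarrow> (f i, f (Suc i)) \<in> R"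
    using walk_dist_relpow[OF assms] unfolding relpow_fun_conv by blast
  have dist: "walk_dist R (f i) v = ?d - i" if "i \<le> ?d" for i
  proof (rule antisym)
    have tl: "(f i, v) \<in> R ^^ (?d - i)" using relpow_segment[where f = f and R = R and n = ?d and i = i and j = ?d] f(2,3) that by auto
    then show "walk_dist R (f i) v \<le> ?d - i" by (rule walk_dist_le)
    have "(u, f i) \<in> R ^^ i" using relpow_segment[where f = f and R = R and n = ?d and i = 0 and j = i] f(1,3) that by auto
    moreover have "(f i, v) \<in> R ^^ walk_dist R (f i) v"
      using tl relpow_imp_rtrancl walk_dist_relpow by metis
    ultimately have "(u, v) \<in> R ^^ (i + walk_dist R (f i) v)"
      unfolding relpow_add by blast
    then show "?d - i \<le> walk_dist R (f i) v" using walk_dist_le by fastforce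
  qed
  have "inj_on f {..?d}"
  proof (rule inj_onI)
    fix i j assume "i \<in> {..?d}" "j \<in> {..?d}" "f i = f j"
    then show "i = j" using dist[of i] dist[of j] by auto
  qed
  then show thesis using that f dist by blast
qed

lemma walk_dist_less_card:
  assumes "(u, v) \<in> R\<^sup>*" "R \<subseteq> V \<times> V" "finite V" "u \<in> V"
  shows "walk_dist R u v < card V"
proof -
  obtain f where f: "f 0 = u" "\<And>i. i < walk_dist R u v \<Longrightarrow> (f i, f (Suc i)) \<in> R"
    "inj_on f {..walk_dist R u v}"
    using shortest_walk[OF assms(1)] by metis
  have "f i \<in> V" if "i \<le> walk_dist R u v" for i
    using that f(1) f(2)[of "i - 1"] assms(2,4) by (cases i) auto
  then have "f ` {..walk_dist R u v} \<subseteq> V" by auto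
  from card_inj_on_le[OF f(3) this assms(3)] show ?thesis by simp
qed

section \<open>Trees\<close>

lemma adj_iff: "(u, v) \<in> adj T \<longleftrightarrow> {u, v} \<in> T"
  by (simp add: adj_def)

lemma sym_adj: "sym (adj T)"
  by (auto simp: sym_def adj_def insert_commute)

lemma adj_mono: "S \<subseteq> T \<Longrightarrow> adj S \<subseteq> adj T"
  by (auto simp: adj_def)

lemma adj_rtrancl_sym: "(u, v) \<in> (adj T)\<^sup>* \<Longrightarrow> (v, u) \<in> (adj T)\<^sup>*"
  by (rule symD[OF sym_rtrancl[OF sym_adj]])

definition adj_on :: "nat set set \<Rightarrow> nat set \<Rightarrow> (nat \<times> nat) set" where
  "adj_on T S = adj T \<inter> S \<times> S"

lemma adj_on_rtrancl_sym: "(u, v) \<in> (adj_on T S)\<^sup>* \<Longrightarrow> (v, u) \<in> (adj_on T S)\<^sup>*"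
  by (rule symD[OF sym_rtrancl]) (auto simp: sym_def adj_on_def adj_def insert_commute)

lemma adj_on_rtrancl_mono: "(u, v) \<in> (adj_on T S)\<^sup>* \<Longrightarrow> S \<subseteq> S' \<Longrightarrow> (u, v) \<in> (adj_on T S')\<^sup>*"
  by (rule rtrancl_mono[THEN subsetD]) (auto simp: adj_on_def)

lemma adj_on_rtrancl_mem: "(u, v) \<in> (adj_on T S)\<^sup>* \<Longrightarrow> u \<in> S \<Longrightarrow> v \<in> S"
  by (induction rule: rtrancl_induct) (auto simp: adj_on_def)

text \<open>A shortest walk from \<open>a\<close> to \<open>b\<close> that avoids \<open>v\<close>
  has distinct nodes and closes through \<open>v\<close> to a cycle.\<close>

lemma acyclic_neighbour_unique:
  assumes "\<nexists>p. cycle T p" "{v, a} \<in> T" "{v, b} \<in> T" "(a, b) \<in> (adj_on T (- {v}))\<^sup>*"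
  shows "a = b"
proof (rule ccontr)
  assume "a \<noteq> b"
  define d where "d = walk_dist (adj_on T (- {v})) a b"
  obtain f where f: "f 0 = a" "f d = b"
    "\<And>i. i < d \<Longrightarrow> (f i, f (Suc i)) \<in> adj_on T (- {v})" "inj_on f {..d}"
    using shortest_walk[OF assms(4)] unfolding d_def by metis
  have "d > 0" using f(1,2) \<open>a \<noteq> b\<close> by (cases d) auto
  have nv: "f i \<noteq> v" if "i \<le> d" for i
  proof (cases "i < d")
    case True
    then show ?thesis using f(3)[of i] by (auto simp: adj_on_def)
  next
    case False
    then show ?thesis using that f(3)[of "d - 1"] \<open>d > 0\<close> by (auto simp: adj_on_def)
  qed
  \<comment> \<open>\<open>v\<close> takes index 0, so \<open>f i\<close> sits at index
    \<open>Suc i\<close>; the wrap-around at index \<open>Suc d\<close> is the edge from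
    \<open>b\<close> back to \<open>v\<close>.\<close>
  let ?p = "v # map f [0..<Suc d]"
  have "distinct ?p"
  proof -
    have "set [0..<Suc d] = {..d}" by auto
    then show ?thesis using nv f(4) by (auto simp: distinct_map simp del: upt_Suc)
  qed
  moreover have "{?p ! i, ?p ! (Suc i mod length ?p)} \<in> T" if "i < length ?p" for i
  proof (cases "i = Suc d")
    case True
    then show ?thesis using f(2) assms(3) by (simp add: insert_commute del: upt_Suc)
  next
    case False
    then have i: "i \<le> d" using that by simp
    show ?thesis
    proof (cases i)
      case 0
      then show ?thesis using f(1) assms(2) by (simp del: upt_Suc)
    next
      case (Suc k)
      then have "{f k, f (Suc k)} \<in> T" using f(3)[of k] i by (auto simp: adj_on_def adj_def)
      then show ?thesis using Suc i by (simp del: upt_Suc)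
    qed
  qed
  moreover have "3 \<le> length ?p" using \<open>d > 0\<close> by simp
  ultimately show False using assms(1) unfolding cycle_def by blast
qed

lemma tree_parent_unique:
  assumes "\<nexists>p. cycle T p" "{v, a} \<in> T" "{v, b} \<in> T" "a \<noteq> v" "b \<noteq> v"
    and "(a, r) \<in> (adj T)\<^sup>*" "(b, r) \<in> (adj T)\<^sup>*"
    and "walk_dist (adj T) a r \<le> walk_dist (adj T) v r"
    and "walk_dist (adj T) b r \<le> walk_dist (adj T) v r"
  shows "a = b"
proof -
  have avoid: "(x, r) \<in> (adj_on T (- {v}))\<^sup>*"
    if x: "x \<noteq> v" "(x, r) \<in> (adj T)\<^sup>*" "walk_dist (adj T) x r \<le> walk_dist (adj T) v r" for x
  proof -
    define d where "d = walk_dist (adj T) x r"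
    obtain f where f: "f 0 = x" "f d = r"
      "\<And>i. i < d \<Longrightarrow> (f i, f (Suc i)) \<in> adj T"
      "\<And>i. i \<le> d \<Longrightarrow> walk_dist (adj T) (f i) r = d - i"
      using shortest_walk[OF x(2)] unfolding d_def by metis
    have "f i \<noteq> v" if "i \<le> d" for i
      using that f(1) f(4)[of i] x(1,3) d_def by (cases i) auto
    then have "(f 0, f d) \<in> (adj_on T (- {v}))\<^sup>*"
      by (intro rtrancl_segment) (use f(3) in \<open>auto simp: adj_on_def\<close>)
    then show ?thesis using f by simp
  qed
  have "(a, b) \<in> (adj_on T (- {v}))\<^sup>*"
    using rtrancl_trans[OF avoid[of a] adj_on_rtrancl_sym[OF avoid[of b]]] assms by blast
  then show ?thesis by (rule acyclic_neighbour_unique[OF assms(1-3)])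
qed

lemma tree_parent_exists:
  assumes "(v, r) \<in> (adj T)\<^sup>*" "v \<noteq> r"
  obtains u where "{v, u} \<in> T" "walk_dist (adj T) v r = Suc (walk_dist (adj T) u r)"
proof -
  obtain f where f: "f 0 = v" "f (walk_dist (adj T) v r) = r"
    "\<And>i. i < walk_dist (adj T) v r \<Longrightarrow> (f i, f (Suc i)) \<in> adj T"
    "\<And>i. i \<le> walk_dist (adj T) v r \<Longrightarrow> walk_dist (adj T) (f i) r = walk_dist (adj T) v r - i"
    using shortest_walk[OF assms(1)] by metis
  have "walk_dist (adj T) v r > 0" using f(1,2) assms(2) by (cases "walk_dist (adj T) v r") auto
  then show thesis using that[of "f 1"] f(1) f(3)[of 0] f(4)[of 1] by (simp add: adj_def)
qed

section \<open>Counting the edges of trees, and exchanging edges\<close>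

text \<open>Sending each node except a root to the edge towards its parent is injective: an edge
  chosen from both ends would make each end farther than the other.\<close>

lemma connected_graph_card_le:
  assumes "finite V" "finite T" "connected_graph V T"
  shows "card V \<le> Suc (card T)"
proof (cases "V = {}")
  case False
  then obtain r where r: "r \<in> V" by blast
  let ?d = "\<lambda>v. walk_dist (adj T) v r"
  have "\<exists>u. {v, u} \<in> T \<and> ?d v = Suc (?d u)" if "v \<in> V - {r}" for v
  proof -
    have "(v, r) \<in> (adj T)\<^sup>*" "v \<noteq> r" using assms(3) r that by (auto simp: connected_graph_def)
    then show ?thesis by (rule tree_parent_exists) blast
  qed
  then obtain par where par: "\<And>v. v \<in> V - {r} \<Longrightarrow> {v, par v} \<in> T \<and> ?d v = Suc (?d (par v))"
    by metis
  have "inj_on (\<lambda>v. {v, par v}) (V - {r})"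
  proof (rule inj_onI)
    fix u v assume uv: "u \<in> V - {r}" "v \<in> V - {r}" "{u, par u} = {v, par v}"
    then show "u = v" using par[OF uv(1)] par[OF uv(2)] by (auto simp: doubleton_eq_iff)
  qed
  then have "card (V - {r}) \<le> card T"
    using par assms(2) by (intro card_inj_on_le[of "\<lambda>v. {v, par v}"]) auto
  then show ?thesis using r assms(1) by (simp add: card_Diff_singleton)
qed simp

lemma simple_graph_finite:
  assumes "simple_graph V E"
  shows "finite E"
proof (rule finite_subset)
  show "E \<subseteq> Pow V" using assms by (auto simp: simple_graph_def)
qed (use assms in \<open>simp add: simple_graph_def\<close>)

text \<open>In the acyclic case the parent edges exhaust the tree: the farther end of an edge is not
  the root, and its other end is the only neighbour that is not farther.\<close>

lemma tree_card:
  assumes "simple_graph V T" "connected_graph V T" "\<nexists>p. cycle T p"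
  shows "card V = Suc (card T)"
proof -
  have V: "finite V" and T: "\<And>e. e \<in> T \<Longrightarrow> e \<subseteq> V \<and> card e = 2" and "V \<noteq> {}"
    using assms(1) by (auto simp: simple_graph_def)
  then obtain r where r: "r \<in> V" by blast
  let ?d = "\<lambda>v. walk_dist (adj T) v r"
  have reach: "(v, r) \<in> (adj T)\<^sup>*" if "v \<in> V" for v
    using assms(2) r that by (auto simp: connected_graph_def)
  have "\<exists>u. {v, u} \<in> T \<and> ?d v = Suc (?d u)" if "v \<in> V - {r}" for v
  proof -
    have "(v, r) \<in> (adj T)\<^sup>*" "v \<noteq> r" using reach that by auto
    then show ?thesis by (rule tree_parent_exists) blast
  qed
  then obtain par where par: "\<And>v. v \<in> V - {r} \<Longrightarrow> {v, par v} \<in> T \<and> ?d v = Suc (?d (par v))"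
    by metis
  have "T \<subseteq> (\<lambda>v. {v, par v}) ` (V - {r})"
  proof
    fix e assume e: "e \<in> T"
    obtain a' b' where "e = {a', b'}" "a' \<noteq> b'" using T[OF e] by (auto simp: card_2_iff)
    then obtain a b where ab: "e = {a, b}" "a \<noteq> b" "?d b \<le> ?d a"
      by (cases "?d a' \<le> ?d b'") (auto simp: insert_commute)
    have abV: "a \<in> V" "b \<in> V" using T[OF e] ab by auto
    have "a \<noteq> r"
    proof
      assume "a = r"
      then have "?d b = 0" using ab by simp
      then have "b = r" using walk_dist_relpow[OF reach[OF abV(2)]] by simp
      then show False using ab \<open>a = r\<close> by simp
    qed
    then have a: "a \<in> V - {r}" using abV by simp
    have "par a \<noteq> a" using par[OF a] by auto
    moreover have "par a \<in> V" using par[OF a] T by blast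
    ultimately have "par a = b"
      using par[OF a] e ab abV
      by (intro tree_parent_unique[OF assms(3), of a "par a" b r]) (auto intro: reach)
    then show "e \<in> (\<lambda>v. {v, par v}) ` (V - {r})" using ab a by auto
  qed
  then have "card T \<le> card (V - {r})" using V by (intro surj_card_le) auto
  moreover have "finite T" using assms(1) by (rule simple_graph_finite)
  ultimately have "card V \<le> Suc (card T)" "card (V - {r}) \<ge> card T"
    using connected_graph_card_le[OF V _ assms(2)] by auto
  moreover have "card V = Suc (card (V - {r}))" using V r by (rule card.remove)
  ultimately show ?thesis by simp
qed

text \<open>A walk is rerouted around \<open>{u, v}\<close> at each use. This covers deleting an
  edge of a cycle as well as exchanging an edge.\<close>

lemma connected_graph_replace:
  assumes "connected_graph V T" "(u, v) \<in> (adj T')\<^sup>*" "T - {{u, v}} \<subseteq> T'"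
  shows "connected_graph V T'"
proof -
  have "adj T \<subseteq> (adj T')\<^sup>*"
  proof
    fix z assume "z \<in> adj T"
    then obtain a b where z: "z = (a, b)" "{a, b} \<in> T" by (auto simp: adj_def)
    show "z \<in> (adj T')\<^sup>*"
    proof (cases "{a, b} = {u, v}")
      case True
      then show ?thesis using assms(2) adj_rtrancl_sym[OF assms(2)] z by (auto simp: doubleton_eq_iff)
    next
      case False
      then show ?thesis using z assms(3) by (auto simp: adj_def)
    qed
  qed
  then have "(adj T)\<^sup>* \<subseteq> (adj T')\<^sup>*" using rtrancl_subset_rtrancl by blast
  then show ?thesis using assms(1) by (auto simp: connected_graph_def)
qed

text \<open>Deleting one edge of a cycle would keep the graph connected, with too few edges for
  \<open>connected_graph_card_le\<close>.\<close>

lemma card_connected_imp_acyclic: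
  assumes "finite V" "finite T" "connected_graph V T" "card V = Suc (card T)"
  shows "\<nexists>p. cycle T p"
proof
  assume "\<exists>p. cycle T p"
  then obtain p where p: "3 \<le> length p" "distinct p"
    "\<And>i. i < length p \<Longrightarrow> {p ! i, p ! (Suc i mod length p)} \<in> T"
    by (auto simp: cycle_def)
  define l where "l = length p - 1"
  \<comment> \<open>The closing edge is deleted because the rest of the cycle is then a walk along
    the list without wrap-around.\<close>
  define e where "e = {p ! 0, p ! l}"
  have "e \<in> T" 
  proof -
    have l: "Suc l = length p" using p(1) by (simp add: l_def)
    then have "{p ! l, p ! 0} \<in> T" using p(3)[of l] by (simp flip: l)
    then show ?thesis by (simp add: e_def insert_commute)
  qed
  have "(p ! k, p ! Suc k) \<in> adj (T - {e})" if "k < l" for k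
  proof -
    have "{p ! k, p ! Suc k} \<in> T" using p(3)[of k] that by (simp add: l_def)
    moreover have "{p ! k, p ! Suc k} \<noteq> e"
    proof
      have k: "k < length p" "Suc k < length p" "0 < length p" "l < length p"
        using p(1) that by (auto simp: l_def)
      assume "{p ! k, p ! Suc k} = e"
      then have "k = 0 \<and> Suc k = l \<or> k = l \<and> Suc k = 0"
        using nth_eq_iff_index_eq[OF p(2)] k by (auto simp: e_def doubleton_eq_iff)
      then show False using p(1) that by (auto simp: l_def)
    qed
    ultimately show ?thesis by (simp add: adj_def)
  qed
  then have "(p ! 0, p ! l) \<in> (adj (T - {e}))\<^sup>*" by (rule rtrancl_segment[where f = "\<lambda>k. p ! k"]) auto
  then have "connected_graph V (T - {e})"
    using connected_graph_replace[OF assms(3)] by (auto simp: e_def)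
  then have "card V \<le> Suc (card (T - {e}))" using connected_graph_card_le assms(1,2) by blast
  moreover have "card (T - {e}) < card T" using \<open>e \<in> T\<close> assms(2) by (meson card_Diff1_less)
  ultimately show False using assms(4) by simp
qed

lemma simple_graph_subset: "simple_graph V E \<Longrightarrow> T \<subseteq> E \<Longrightarrow> simple_graph V T"
  unfolding simple_graph_def by blast

text \<open>Turns acyclicity into a count, so that an exchange of edges has to be checked for
  connectedness only.\<close>

lemma spanning_tree_iff_card:
  assumes "simple_graph V E"
  shows "spanning_tree V E T \<longleftrightarrow> T \<subseteq> E \<and> connected_graph V T \<and> card V = Suc (card T)"
proof -
  have "finite V" using assms by (simp add: simple_graph_def)
  show ?thesis
  proof (cases "T \<subseteq> E")
    case True
    then have T: "simple_graph V T" "finite T"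
      using simple_graph_subset[OF assms] simple_graph_finite by auto
    show ?thesis
      using tree_card[OF T(1)] card_connected_imp_acyclic[OF \<open>finite V\<close> T(2)] True
      unfolding spanning_tree_def by blast
  qed (simp add: spanning_tree_def)
qed

lemma spanning_tree_exchange:
  assumes "simple_graph V E" "spanning_tree V E T" "{a, b} \<in> T" "g \<in> E" "g \<notin> T"
    "(a, b) \<in> (adj (insert g (T - {{a, b}})))\<^sup>*"
  shows "spanning_tree V E (insert g (T - {{a, b}}))"
proof -
  have T: "T \<subseteq> E" "connected_graph V T" "card V = Suc (card T)"
    using assms(2) spanning_tree_iff_card[OF assms(1)] by auto
  have "finite T" using T(1) simple_graph_finite[OF assms(1)] finite_subset by blast
  have "connected_graph V (insert g (T - {{a, b}}))"
    by (rule connected_graph_replace[OF T(2) assms(6)]) auto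
  moreover have "card (insert g (T - {{a, b}})) = card T"
  proof -
    have "g \<notin> T - {{a, b}}" using assms(5) by simp
    then show ?thesis
      using card.remove[OF \<open>finite T\<close> assms(3)] \<open>finite T\<close> by (metis card_insert_disjoint finite_Diff)
  qed
  ultimately show ?thesis
    using T assms(4) unfolding spanning_tree_iff_card[OF assms(1)] by auto
qed

section \<open>Minimum spanning trees\<close>

lemma rtrancl_crossing:
  assumes "(u, v) \<in> R\<^sup>*" "u \<in> S" "v \<notin> S"
  obtains a b where "(a, b) \<in> R" "a \<in> S" "b \<notin> S"
proof -
  have "v \<notin> S \<Longrightarrow> \<exists>a b. (a, b) \<in> R \<and> a \<in> S \<and> b \<notin> S"
    using assms(1,2) by (induction rule: rtrancl_induct) auto
  then show thesis using that assms(3) by blast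
qed

text \<open>Any edge on the tree path between \<open>u\<close> and \<open>v\<close> can be exchanged
  for \<open>{u, v}\<close>, so minimality bounds its weight.\<close>

lemma minimal_spanning_tree_walk:
  fixes w :: "nat set \<Rightarrow> nat"
  assumes "simple_graph V E" "spanning_tree V E T"
    and min: "\<And>T'. spanning_tree V E T' \<Longrightarrow> sum w T \<le> sum w T'"
    and "{u, v} \<in> E" "{u, v} \<notin> T"
  shows "(u, v) \<in> (adj {e \<in> T. w e \<le> w {u, v}})\<^sup>*"
proof -
  let ?g = "{u, v}"
  have T: "T \<subseteq> E" "connected_graph V T" using assms(2) by (auto simp: spanning_tree_def)
  have "u \<in> V" "v \<in> V" using assms(1,4) by (auto simp: simple_graph_def)
  then have "(u, v) \<in> (adj T)\<^sup>*" using T(2) by (auto simp: connected_graph_def)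
  then obtain f where f: "f 0 = u" "f (walk_dist (adj T) u v) = v"
    "\<And>i. i < walk_dist (adj T) u v \<Longrightarrow> (f i, f (Suc i)) \<in> adj T"
    "inj_on f {..walk_dist (adj T) u v}"
    using shortest_walk by metis
  define d where "d = walk_dist (adj T) u v"
  note f = f[folded d_def]
  have finT: "finite T" using T(1) simple_graph_finite[OF assms(1)] finite_subset by blast
  have light: "w {f i, f (Suc i)} \<le> w ?g" if i: "i < d" for i
  proof -
    let ?e = "{f i, f (Suc i)}"
    let ?T = "insert ?g (T - {?e})"
    have e: "?e \<in> T" using f(3)[OF i] by (simp add: adj_def)
    have step: "(f k, f (Suc k)) \<in> adj ?T" if "k < d" "k \<noteq> i" for k
    proof -
      have "{f k, f (Suc k)} \<noteq> ?e"
      proof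
        assume "{f k, f (Suc k)} = ?e"
        then have "f k = f i \<or> f k = f (Suc i) \<and> f (Suc k) = f i" by (auto simp: doubleton_eq_iff)
        then show False using inj_on_eq_iff[OF f(4)] that i by auto
      qed
      then show ?thesis using f(3)[OF that(1)] by (simp add: adj_def)
    qed
    \<comment> \<open>Without \<open>?e\<close> its ends are joined the other way round: back to
      \<open>u\<close>, across the new edge, and back from \<open>v\<close>.\<close>
    have 1: "(f 0, f i) \<in> (adj ?T)\<^sup>*"
      by (rule rtrancl_segment[where f = f]) (use step i in auto)
    have 2: "(f (Suc i), f d) \<in> (adj ?T)\<^sup>*"
      by (rule rtrancl_segment[where f = f]) (use step i in auto)
    have 3: "(f 0, f d) \<in> adj ?T" using f(1,2) by (simp add: adj_def)
    have "(f i, f (Suc i)) \<in> (adj ?T)\<^sup>*"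
      using adj_rtrancl_sym[OF 1] 3 adj_rtrancl_sym[OF 2] by (meson rtrancl.rtrancl_into_rtrancl rtrancl_trans)
    then have "spanning_tree V E ?T"
      using spanning_tree_exchange[OF assms(1,2) e assms(4,5)] by blast
    then have "sum w T \<le> sum w ?T" by (rule min)
    moreover have "sum w ?T = w ?g + sum w (T - {?e})"
      using finT assms(5) by simp
    moreover have "sum w T = w ?e + sum w (T - {?e})"
      using finT e by (rule sum.remove)
    ultimately show ?thesis by simp
  qed
  have "(f 0, f d) \<in> (adj {e \<in> T. w e \<le> w ?g})\<^sup>*"
    by (rule rtrancl_segment[where f = f]) (use light f(3) in \<open>auto simp: adj_def\<close>)
  then show ?thesis using f by simp
qed

text \<open>An edge \<open>g\<close> of \<open>T'\<close> outside \<open>T\<close> is exchanged for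
  an edge of the light \<open>T\<close>-walk that crosses the cut left by \<open>g\<close>. The
  weight does not grow and \<open>T'\<close> comes closer to \<open>T\<close>, so induction on
  \<open>card (T' - T)\<close> applies.\<close>

lemma spanning_tree_minimal_if_walks:
  fixes w :: "nat set \<Rightarrow> nat"
  assumes "simple_graph V E" "spanning_tree V E T"
    and walks: "\<And>u v. {u, v} \<in> E \<Longrightarrow> {u, v} \<notin> T \<Longrightarrow> (u, v) \<in> (adj {e \<in> T. w e \<le> w {u, v}})\<^sup>*"
    and "spanning_tree V E T'"
  shows "sum w T \<le> sum w T'"
  using assms(4)
proof (induction "card (T' - T)" arbitrary: T' rule: less_induct)
  case (less T')
  have fin: "finite V" "finite E" using assms(1) simple_graph_finite by (auto simp: simple_graph_def)
  have T: "T \<subseteq> E" "card V = Suc (card T)"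
    using assms(2) spanning_tree_iff_card[OF assms(1)] by auto
  have T': "T' \<subseteq> E" "connected_graph V T'" "card V = Suc (card T')"
    using less.prems spanning_tree_iff_card[OF assms(1)] by auto
  have finT: "finite T" "finite T'" using T(1) T'(1) fin(2) by (auto intro: finite_subset)
  show ?case
  proof (cases "T' \<subseteq> T")
    case True
    then have "T' = T" using T(2) T'(3) card_subset_eq[OF finT(1) True] by simp
    then show ?thesis by simp
  next
    case False
    then obtain g where g: "g \<in> T'" "g \<notin> T" by blast
    then have "g \<in> E" using T' by blast
    then have "g \<subseteq> V" "card g = 2" using assms(1) by (auto simp: simple_graph_def)
    then obtain u v where uv: "g = {u, v}" "u \<in> V" "v \<in> V" by (auto simp: card_2_iff)
    let ?H = "T' - {g}"
    define S where "S = {x. (u, x) \<in> (adj ?H)\<^sup>*}"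
    have "v \<notin> S"
    proof
      assume "v \<in> S"
      then have "connected_graph V ?H"
        using connected_graph_replace[OF T'(2), of u v ?H] uv by (auto simp: S_def)
      then have "card V \<le> Suc (card ?H)" using connected_graph_card_le fin finT by blast
      moreover have "card ?H < card T'" using g finT by (meson card_Diff1_less)
      ultimately show False using T'(3) by simp
    qed
    \<comment> \<open>Deleting \<open>g\<close> leaves just the sides of \<open>u\<close> and of
      \<open>v\<close>; hence the far end \<open>b\<close> of the crossing edge is joined to
      \<open>v\<close>, and the exchange reconnects the tree.\<close>
    have sides: "x \<in> S \<or> (x, v) \<in> (adj ?H)\<^sup>*" if "(x, u) \<in> (adj T')\<^sup>*" for x
      using that
    proof (induction rule: converse_rtrancl_induct)
      case (step y z)
      show ?case
      proof (cases "{y, z} = g")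
        case True
        then show ?thesis using uv by (auto simp: S_def doubleton_eq_iff)
      next
        case False
        then have "(y, z) \<in> adj ?H" "(z, y) \<in> adj ?H"
          using step(1) by (auto simp: adj_def insert_commute)
        then show ?thesis using step(3) unfolding S_def
          by (auto intro: converse_rtrancl_into_rtrancl rtrancl.rtrancl_into_rtrancl)
      qed
    qed (simp add: S_def)
    have "(u, v) \<in> (adj {e \<in> T. w e \<le> w g})\<^sup>*"
      using walks[of u v] g \<open>g \<in> E\<close> uv by auto
    then obtain a b where ab: "(a, b) \<in> adj {e \<in> T. w e \<le> w g}" "a \<in> S" "b \<notin> S"
      by (rule rtrancl_crossing[of _ _ _ S]) (use \<open>v \<notin> S\<close> in \<open>auto simp: S_def\<close>)
    then have f: "{a, b} \<in> T" "w {a, b} \<le> w g" by (auto simp: adj_def)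
    have "{a, b} \<subseteq> V" using f(1) T(1) assms(1) unfolding simple_graph_def by blast
    then have "b \<in> V" by simp
    then have "(b, u) \<in> (adj T')\<^sup>*" using T'(2) uv by (auto simp: connected_graph_def)
    then have bv: "(b, v) \<in> (adj ?H)\<^sup>*" using sides ab(3) by blast
    have "{a, b} \<noteq> g" using f(1) g(2) by auto
    have "{a, b} \<notin> T'"
    proof
      assume "{a, b} \<in> T'"
      then have "(a, b) \<in> adj ?H" using \<open>{a, b} \<noteq> g\<close> by (simp add: adj_def)
      then show False using ab(2,3) unfolding S_def
        by (auto intro: rtrancl.rtrancl_into_rtrancl)
    qed
    let ?T = "insert {a, b} ?H"
    have mono: "(adj ?H)\<^sup>* \<subseteq> (adj ?T)\<^sup>*" by (rule rtrancl_mono[OF adj_mono]) auto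
    have "(u, a) \<in> (adj ?T)\<^sup>*" using ab(2) mono unfolding S_def by blast
    also have "(a, b) \<in> adj ?T" by (simp add: adj_def)
    also have "(b, v) \<in> (adj ?T)\<^sup>*" using bv mono by blast
    finally have "(u, v) \<in> (adj ?T)\<^sup>*" .
    then have tree: "spanning_tree V E ?T"
      using spanning_tree_exchange[OF assms(1) less.prems, of u v "{a, b}", folded uv(1), OF g(1)]
        f(1) T(1) \<open>{a, b} \<notin> T'\<close> by blast
    have "?T - T \<subseteq> T' - T - {g}" using f(1) by blast
    then have "card (?T - T) \<le> card (T' - T - {g})" by (rule card_mono[rotated]) (simp add: finT)
    also have "\<dots> < card (T' - T)" by (rule card_Diff1_less) (simp_all add: finT g)
    finally have "sum w T \<le> sum w ?T" using less.hyps tree by blast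
    also have "\<dots> = w {a, b} + sum w ?H"
      by (rule sum.insert) (simp_all add: finT \<open>{a, b} \<notin> T'\<close>)
    also have "\<dots> \<le> w g + sum w ?H" using f(2) by (rule add_right_mono)
    also have "\<dots> = sum w T'" using sum.remove[OF finT(2) g(1), of w] by (rule sym)
    finally show ?thesis .
  qed
qed

section \<open>Vertex rankings of trees\<close>

definition component :: "nat set set \<Rightarrow> nat set \<Rightarrow> nat \<Rightarrow> nat set" where
  "component T S v = {u. (v, u) \<in> (adj_on T S)\<^sup>*}"

lemma component_self [simp]: "v \<in> component T S v"
  by (simp add: component_def)

lemma component_subset: "v \<in> S \<Longrightarrow> component T S v \<subseteq> S"
  using adj_on_rtrancl_mem by (auto simp: component_def)

lemma component_eq: "u \<in> component T S v \<Longrightarrow> component T S u = component T S v"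
  unfolding component_def by (auto dest: adj_on_rtrancl_sym intro: rtrancl_trans[of u] rtrancl_trans[of v])

lemma component_mono: "S \<subseteq> S' \<Longrightarrow> component T S v \<subseteq> component T S' v"
  unfolding component_def using adj_on_rtrancl_mono by blast

lemma component_exit:
  assumes "u \<in> S - {c}" "(a, b) \<in> adj_on T S" "a \<in> component T (S - {c}) u" "b \<notin> component T (S - {c}) u"
  shows "b = c"
proof (rule ccontr)
  assume "b \<noteq> c"
  moreover have "a \<in> S - {c}" using component_subset[OF assms(1)] assms(3) by blast
  ultimately have "(a, b) \<in> adj_on T (S - {c})" using assms(2) by (auto simp: adj_on_def)
  then show False using assms(3,4) unfolding component_def
    by (auto intro: rtrancl.rtrancl_into_rtrancl)
qed

text \<open>Otherwise every node of the component leaves a part of more than half after its removal.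
  Take such a part \<open>B\<close> of least size, cut off by \<open>c\<close>, and move from
  \<open>c\<close> to its neighbour \<open>c'\<close> in \<open>B\<close>. The large part
  \<open>B'\<close> at \<open>c'\<close> meets \<open>B\<close>; it contains \<open>c\<close> only
  if there is a cycle, and otherwise it lies strictly inside \<open>B\<close>.\<close>

lemma tree_centroid:
  assumes "\<nexists>p. cycle T p" "finite S" "v \<in> S"
  obtains c where "c \<in> component T S v"
    "\<And>u. u \<in> component T S v - {c} \<Longrightarrow> 2 * card (component T (S - {c}) u) \<le> card (component T S v)"
proof (rule ccontr)
  note centroid = that
  let ?K = "component T S v"
  let ?B = "\<lambda>(c, u). component T (S - {c}) u"
  let ?bad = "\<lambda>(c, u). c \<in> ?K \<and> u \<in> ?K - {c} \<and> card ?K < 2 * card (?B (c, u))"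
  assume "\<not> thesis"
  then have ex: "\<exists>u. ?bad (c, u)" if "c \<in> ?K" for c
    using centroid[OF that] that by (metis (mono_tags, lifting) case_prod_conv not_le)
  have "\<exists>z. ?bad z" using ex[OF component_self] by (rule exE) (rule exI[of ?bad])
  then obtain z where z: "?bad z" "\<And>y. ?bad y \<Longrightarrow> card (?B z) \<le> card (?B y)"
    using ex_has_least_nat[of ?bad _ "\<lambda>z. card (?B z)"] by blast
  obtain c u where cu: "z = (c, u)" by (cases z)
  define B where "B = component T (S - {c}) u"
  have KS: "?K \<subseteq> S" using assms(3) by (rule component_subset)
  have finK: "finite ?K" using KS assms(2) finite_subset by blast
  have c: "c \<in> ?K" and u: "u \<in> ?K" "u \<noteq> c" and big: "card ?K < 2 * card B"
    using z(1) by (auto simp: cu B_def)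
  have uS: "u \<in> S - {c}" using u KS by blast
  have BS: "B \<subseteq> S - {c}" unfolding B_def using uS by (rule component_subset)
  have BK: "B \<subseteq> ?K"
    using component_mono[of "S - {c}" S T u] component_eq[OF u(1)] by (auto simp: B_def)
  have "(u, c) \<in> (adj_on T S)\<^sup>*"
    using component_eq[OF u(1)] c by (auto simp: component_def)
  then obtain c' b where "(c', b) \<in> adj_on T S" "c' \<in> B" "b \<notin> B"
    by (rule rtrancl_crossing[of _ _ _ B]) (use BS in \<open>auto simp: B_def\<close>)
  moreover from this have "b = c" unfolding B_def by (intro component_exit[OF uS])
  ultimately have c': "(c', c) \<in> adj_on T S" "c' \<in> B" by auto
  then have "c' \<in> ?K" using BK by blast
  then obtain u' where u': "?bad (c', u')" using ex by blast
  define B' where "B' = component T (S - {c'}) u'"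
  have uS': "u' \<in> S - {c'}" using u' KS by auto
  have BS': "B' \<subseteq> S - {c'}" unfolding B'_def using uS' by (rule component_subset)
  have BK': "B' \<subseteq> ?K"
    using component_mono[of "S - {c'}" S T u'] component_eq[of u' T S v] u' by (auto simp: B'_def)
  have big': "card ?K < 2 * card B'" using u' by (simp add: B'_def)
  have "B \<inter> B' \<noteq> {}"
  proof
    assume "B \<inter> B' = {}"
    then have "card B + card B' = card (B \<union> B')"
      using BK BK' finK finite_subset by (metis card_Un_disjoint)
    also have "\<dots> \<le> card ?K" using BK BK' finK by (intro card_mono) auto
    finally show False using big big' by simp
  qed
  then obtain y where y: "y \<in> B" "y \<in> B'" by blast
  have conn': "(x, y) \<in> (adj_on T (S - {c'}))\<^sup>*" if "x \<in> B'" for x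
    using that y(2) component_eq[of x T "S - {c'}" u'] by (auto simp: B'_def component_def)
  show False
  proof (cases "c \<in> B'")
    case True
    \<comment> \<open>A walk from \<open>y\<close> to \<open>c\<close> around \<open>c'\<close>
      would leave \<open>B\<close> through a second neighbour of \<open>c\<close> in
      \<open>B\<close>.\<close>
    have "(y, c) \<in> (adj_on T (S - {c'}))\<^sup>*" using conn'[OF True] adj_on_rtrancl_sym by blast
    then obtain b a where ba: "(b, a) \<in> adj_on T (S - {c'})" "b \<in> B" "a \<notin> B"
      by (rule rtrancl_crossing[of _ _ _ B]) (use BS y in auto)
    then have "a = c" unfolding B_def by (intro component_exit[OF uS]) (auto simp: adj_on_def)
    have "(b, c') \<in> (adj_on T (S - {c}))\<^sup>*"
      using component_eq[of b T "S - {c}" u] ba(2) c'(2) by (auto simp: B_def component_def)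
    then have "(b, c') \<in> (adj_on T (- {c}))\<^sup>*" by (rule adj_on_rtrancl_mono) auto
    then have "b = c'"
      using acyclic_neighbour_unique[OF assms(1), of c b c'] ba c' \<open>a = c\<close>
      by (auto simp: adj_on_def adj_def insert_commute)
    then show False using ba by (auto simp: adj_on_def)
  next
    case False
    have "(y, x) \<in> (adj_on T (S - {c}))\<^sup>*" if "(y, x) \<in> (adj_on T (S - {c'}))\<^sup>*" for x
      using that
    proof (induction rule: rtrancl_induct)
      case (step p q)
      have "p \<in> B'" "q \<in> B'"
        using y(2) step(1,2) unfolding B'_def component_def
        by (auto intro: rtrancl_trans rtrancl.rtrancl_into_rtrancl)
      then have "(p, q) \<in> adj_on T (S - {c})" using step(2) False by (auto simp: adj_on_def)
      then show ?case using step(3) by (rule rtrancl.rtrancl_into_rtrancl[rotated])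
    qed simp
    then have "B' \<subseteq> B"
      using conn' adj_on_rtrancl_sym component_eq[of y T "S - {c}" u] y(1)
      unfolding B_def component_def by blast
    then have "B' \<subset> B" using c'(2) BS' by blast
    then have "card B' < card B" using finK BK finite_subset by (metis psubset_card_mono)
    then show False using z(2)[OF u'] by (simp add: cu B_def B'_def)
  qed
qed

text \<open>The top level goes to one centroid of every component; deleting them at least halves
  each component, so the exponent drops by one. The second conjunct is the usual ranking condition:
  a path in \<open>S\<close> between distinct nodes of equal level passes a higher one.\<close>

lemma vertex_ranking_exists:
  assumes "\<nexists>p. cycle T p" "finite S" "\<forall>v\<in>S. card (component T S v) < 2 ^ k"
  shows "\<exists>l :: nat \<Rightarrow> nat. (\<forall>v\<in>S. l v < k) \<and>
    (\<forall>u\<in>S. \<forall>v\<in>S. l u = l v \<longrightarrow> (u, v) \<in> (adj_on T {y \<in> S. l y \<le> l u})\<^sup>* \<longrightarrow> u = v)"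
  using assms(2,3)
proof (induction k arbitrary: S)
  case 0
  have "S = {}"
  proof (rule ccontr)
    assume "S \<noteq> {}"
    then obtain v where v: "v \<in> S" by blast
    then have "card (component T S v) < 1" using 0(2) by simp
    then have "component T S v = {}"
      using finite_subset[OF component_subset[OF v] 0(1)] by simp
    then show False using component_self by blast
  qed
  then show ?case by simp
next
  case (Suc k)
  let ?cen = "\<lambda>K c. c \<in> K \<and> (\<forall>u\<in>K - {c}. 2 * card (component T (S - {c}) u) \<le> card K)"
  have "\<exists>c. ?cen (component T S v) c" if "v \<in> S" for v
    by (rule tree_centroid[OF assms(1) Suc.prems(1) that]) blast
  \<comment> \<open>The centroid is chosen per component and not per node, so that all nodes of a
    component agree on it.\<close>
  then have "\<forall>K\<in>component T S ` S. \<exists>c. ?cen K c" by blast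
  then obtain cen where cen': "\<forall>K\<in>component T S ` S. ?cen K (cen K)"
    by (rule bchoice[THEN exE])
  have cen: "cen (component T S v) \<in> component T S v" if "v \<in> S" for v
    using cen' that by blast
  have cen_half: "2 * card (component T (S - {cen (component T S v)}) u) \<le> card (component T S v)"
    if "v \<in> S" "u \<in> component T S v - {cen (component T S v)}" for u v
    using cen' that by blast
  let ?c = "\<lambda>v. cen (component T S v)"
  define S' where "S' = S - ?c ` S"
  have small: "\<forall>u\<in>S'. card (component T S' u) < 2 ^ k"
  proof
    fix u assume u: "u \<in> S'"
    have uS: "u \<in> S" "u \<noteq> ?c u" using u by (auto simp: S'_def)
    have "component T S' u \<subseteq> component T (S - {?c u}) u"
      by (rule component_mono) (use uS in \<open>auto simp: S'_def\<close>)
    moreover have "finite (component T (S - {?c u}) u)"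
      using component_subset[of u "S - {?c u}" T] uS Suc.prems(1) finite_subset by blast
    ultimately have "card (component T S' u) \<le> card (component T (S - {?c u}) u)"
      by (intro card_mono)
    moreover have "2 * card (component T (S - {?c u}) u) \<le> card (component T S u)"
      using cen_half[OF uS(1), of u] uS(2) by simp
    ultimately show "card (component T S' u) < 2 ^ k" using bspec[OF Suc.prems(2) uS(1)] by simp
  qed
  have "finite S'" using Suc.prems(1) by (simp add: S'_def)
  from Suc.IH[OF this small]
  obtain l' where IH: "\<forall>v\<in>S'. l' v < k"
    "\<forall>u\<in>S'. \<forall>v\<in>S'. l' u = l' v \<longrightarrow> (u, v) \<in> (adj_on T {y \<in> S'. l' y \<le> l' u})\<^sup>* \<longrightarrow> u = v"
    by (elim exE conjE)
  have l': "\<And>v. v \<in> S' \<Longrightarrow> l' v < k"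
    "\<And>u v. \<lbrakk>u \<in> S'; v \<in> S'; l' u = l' v; (u, v) \<in> (adj_on T {y \<in> S'. l' y \<le> l' u})\<^sup>*\<rbrakk> \<Longrightarrow> u = v"
    using IH by simp_all
  define l where "l v = (if v \<in> ?c ` S then k else l' v)" for v
  have l: "v \<in> S' \<and> l v = l' v \<and> l' v < k \<or> v \<notin> S' \<and> l v = k" if "v \<in> S" for v
    using that l'(1)[of v] by (auto simp: l_def S'_def)
  have "u = v" if uv: "u \<in> S" "v \<in> S" "l u = l v" "(u, v) \<in> (adj_on T {y \<in> S. l y \<le> l u})\<^sup>*" for u v
  proof (cases "u \<in> S'")
    case True
    then have "v \<in> S'" "l' u = l' v" using l[OF uv(1)] l[OF uv(2)] uv(3) by auto
    moreover have "{y \<in> S. l y \<le> l u} = {y \<in> S'. l' y \<le> l' u}"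
      using True l l'(1)[of u] l[OF uv(1)] by (force simp: S'_def)
    ultimately show ?thesis using l'(2) True uv(4) by simp
  next
    case False
    then have "v \<notin> S'" using l[OF uv(1)] l[OF uv(2)] uv(3) by auto
    \<comment> \<open>A centroid lies in the component it was chosen for, so it is its own centroid;
      two nodes of level \<open>k\<close> in one component coincide.\<close>
    have c: "x = ?c x" if x: "x \<in> S" "x \<notin> S'" for x
    proof -
      obtain x0 where x0: "x0 \<in> S" "x = ?c x0" using x by (auto simp: S'_def)
      then have "component T S x = component T S x0" using cen[OF x0(1)] component_eq by metis
      then show ?thesis using x0 by simp
    qed
    have "(u, v) \<in> (adj_on T S)\<^sup>*" using uv(4) by (rule adj_on_rtrancl_mono) auto
    then have "component T S v = component T S u"
      by (intro component_eq) (simp add: component_def)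
    then show ?thesis using c uv(1,2) False \<open>v \<notin> S'\<close> by metis
  qed
  moreover have "l v < Suc k" if "v \<in> S" for v using l[OF that] by auto
  ultimately show ?case by (intro exI[of _ l]) simp
qed

section \<open>Residues of the depth along tree paths\<close>

lemma residue_shift:
  fixes b q s :: nat
  assumes "0 < s"
  obtains k where "k < s" "(b + k) mod s = q mod s"
proof -
  have "b \<le> s * b" using assms by simp
  \<comment> \<open>Adding the multiple \<open>s * b\<close> before subtracting \<open>b\<close>
    keeps the subtraction from truncating at 0.\<close>
  then have "b + (q + s * b - b) = q + s * b" by linarith
  then have "(b + (q + s * b - b) mod s) mod s = q mod s"
    by (metis mod_add_right_eq mod_mult_self2)
  then show thesis using that[of "(q + s * b - b) mod s"] assms by simp
qed

text \<open>
  A simple path in a rooted tree first ascends and then descends, so among \<open>2 s - 1\<close> consecutive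
  nodes there are \<open>s\<close> along which the depth is monotone, and these meet every residue modulo \<open>s\<close>.
\<close>

lemma unimodal_residue:
  fixes g :: "nat \<Rightarrow> nat"
  assumes step: "\<And>i. i < m \<Longrightarrow> g (Suc i) = Suc (g i) \<or> g i = Suc (g (Suc i))"
    and valley: "\<And>i. Suc i < m \<Longrightarrow> g (Suc i) = Suc (g i) \<Longrightarrow> g (Suc (Suc i)) = Suc (g (Suc i))"
    and "0 < s" "a \<le> m"
  obtains j where "a \<le> j" "j \<le> m" "j \<le> a + 2 * s - 2" "j = m \<or> g j mod s = q mod s"
\<comment> \<open>If the path ends inside the window, its last node is taken. In the application
  this is the centre itself, whose trivial entry needs no residue.\<close>
proof (cases "m \<le> a + 2 * s - 2")
  case True
  then show thesis using that[of m] assms by simp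
next
  case False
  \<comment> \<open>The middle of the window. On the half chosen below, \<open>g\<close> takes the
    values \<open>g e\<close>, ..., \<open>g e + s - 1\<close> outwards from \<open>e\<close>, so a
    single offset \<open>k\<close> serves both cases.\<close>
  define e where "e = a + (s - 1)"
  have e: "a \<le> e" "e + (s - 1) < m" "e + (s - 1) = a + 2 * s - 2" "e - (s - 1) = a" "s - 1 \<le> e"
    using False assms(3) by (auto simp: e_def)
  obtain k where k: "k < s" "(g e + k) mod s = q mod s"
    using residue_shift[OF assms(3)] by blast
  show thesis
  \<comment> \<open>A rise before \<open>e\<close> persists by \<open>valley\<close>, so
    \<open>g\<close> rises on the right half; without one, \<open>g\<close> falls on the whole left
    half.\<close>
  proof (cases "\<exists>i. a \<le> i \<and> i < e \<and> g (Suc i) = Suc (g i)")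
    case True
    then obtain i where i: "a \<le> i" "i < e" "g (Suc i) = Suc (g i)" by blast
    have up: "g (Suc (i + n)) = Suc (g (i + n))" if "i + n < m" for n
      using that by (induction n) (use i(3) valley in auto)
    have "g (e + n) = g e + n" if "e + n \<le> m" for n
      using that
    proof (induction n)
      case (Suc n)
      then have "g (Suc (i + (e + n - i))) = Suc (g (i + (e + n - i)))"
        using i(2) by (intro up) auto
      then show ?case using Suc i(2) by simp
    qed simp
    then have "g (e + k) = g e + k" using k(1) e by simp
    then show thesis using that[of "e + k"] k e by simp
  next
    case False
    have "g (e - n) = g e + n" if "n \<le> s - 1" for n
      using that
    proof (induction n)
      case (Suc n)
      have "Suc (e - Suc n) = e - n" using Suc.prems e by linarith
      moreover have "g (e - Suc n) = Suc (g (Suc (e - Suc n)))"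
        using step[of "e - Suc n"] False Suc.prems e by force
      ultimately show ?case using Suc by simp
    qed simp
    then have "g (e - k) = g e + k" using k(1) by simp
    then show thesis using that[of "e - k"] k e by simp
  qed
qed

section \<open>The verifier\<close>

type_synonym info = "nat \<times> nat \<times> (nat \<times> nat \<times> nat) list"

text \<open>Identities are injective, so an identity inside the view determines the
  certificate.\<close>

definition view_info :: "(certificate \<Rightarrow> info) \<Rightarrow> view \<Rightarrow> nat \<Rightarrow> info" where
  "view_info dec vw a = dec (THE ct. \<exists>ms. (a, ct, ms) \<in> v_nodes vw)"

text \<open>
  Certificates decode to triples: identity of the root of the tree, depth in the tree, and a list
  of entries. An entry \<open>(c, x, k)\<close> at a node claims a tree walk to the node with
  identity \<open>c\<close> on edges of weight at most \<open>x\<close>; the pair \<open>(x, k)\<close> decreases lexicographically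
  along the walk. Every node has the trivial entry for itself.
\<close>

definition entries :: "nat \<Rightarrow> info \<Rightarrow> (nat \<times> nat \<times> nat) set" where
  "entries a I = insert (a, 0, 0) (set (snd (snd I)))"

definition view_adj :: "view \<Rightarrow> nat \<Rightarrow> (nat \<times> nat) set" where
  "view_adj vw x = adj {e. \<exists>w\<le>x. (e, w, True) \<in> v_edges vw}"

text \<open>The first four conditions secure the tree. All nodes name the same root, since this is
  compared along all edges of the connected graph, and only that node can have depth 0; so following
  smaller depths connects everything. At most one tree neighbour is not deeper, which forbids
  cycles. Only comparisons of depths matter; they need not be distances. The last two conditions
  carry the weights: a non-tree edge finds two entries with a common centre, and each entry is
  trivial or supported by a smaller one.\<close>

definition mst_verifier :: "(certificate \<Rightarrow> info) \<Rightarrow> view \<Rightarrow> bool" where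
  "mst_verifier dec vw \<longleftrightarrow>
     (let a = v_center vw; I = view_info dec vw; dep = (\<lambda>b. fst (snd (I b)));
          edg = (\<lambda>b w h. ({a, b}, w, h) \<in> v_edges vw) in
      (\<forall>b w h. edg b w h \<longrightarrow> fst (I b) = fst (I a)) \<and>
      (dep a = 0 \<longrightarrow> fst (I a) = a) \<and>
      (0 < dep a \<longrightarrow> (\<exists>b w. edg b w True \<and> dep b < dep a)) \<and>
      (\<forall>b b' w w'. edg b w True \<longrightarrow> edg b' w' True \<longrightarrow> dep b \<le> dep a \<longrightarrow> dep b' \<le> dep a \<longrightarrow> b = b') \<and>
      (\<forall>b w. edg b w False \<longrightarrow> (\<exists>p q c x y k m.
         (a, p) \<in> (view_adj vw w)\<^sup>* \<and> (c, x, k) \<in> entries p (I p) \<and> x \<le> w \<and>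
         (b, q) \<in> (view_adj vw w)\<^sup>* \<and> (c, y, m) \<in> entries q (I q) \<and> y \<le> w)) \<and>
      (\<forall>c x k. (c, x, k) \<in> set (snd (snd (I a))) \<longrightarrow> (c, x, k) = (a, 0, 0) \<or>
         (\<exists>p y m. (a, p) \<in> (view_adj vw x)\<^sup>* \<and> (c, y, m) \<in> entries p (I p) \<and>
            (y < x \<or> y = x \<and> m < k))))"

lemma mst_verifierD:
  assumes "mst_verifier dec vw"
  defines "a \<equiv> v_center vw" and "I \<equiv> view_info dec vw"
  shows "({a, b}, w, h) \<in> v_edges vw \<Longrightarrow> fst (I b) = fst (I a)"
    and "fst (snd (I a)) = 0 \<Longrightarrow> fst (I a) = a"
    and "0 < fst (snd (I a)) \<Longrightarrow> \<exists>b w. ({a, b}, w, True) \<in> v_edges vw \<and> fst (snd (I b)) < fst (snd (I a))"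
    and "({a, b}, w, True) \<in> v_edges vw \<Longrightarrow> ({a, b'}, w', True) \<in> v_edges vw \<Longrightarrow>
      fst (snd (I b)) \<le> fst (snd (I a)) \<Longrightarrow> fst (snd (I b')) \<le> fst (snd (I a)) \<Longrightarrow> b = b'"
    and "({a, b}, w, False) \<in> v_edges vw \<Longrightarrow> \<exists>p q c x y k m.
      (a, p) \<in> (view_adj vw w)\<^sup>* \<and> (c, x, k) \<in> entries p (I p) \<and> x \<le> w \<and>
      (b, q) \<in> (view_adj vw w)\<^sup>* \<and> (c, y, m) \<in> entries q (I q) \<and> y \<le> w"
    and "(c, x, k) \<in> set (snd (snd (I a))) \<Longrightarrow> (c, x, k) = (a, 0, 0) \<or>
      (\<exists>p y m. (a, p) \<in> (view_adj vw x)\<^sup>* \<and> (c, y, m) \<in> entries p (I p) \<and> (y < x \<or> y = x \<and> m < k))"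
  using assms(1) unfolding mst_verifier_def Let_def a_def I_def by blast+

definition light_tree :: "config \<Rightarrow> nat \<Rightarrow> nat set set" where
  "light_tree G x = {e \<in> represented G. wt G e \<le> x}"

lemma light_tree_mono: "x \<le> y \<Longrightarrow> light_tree G x \<subseteq> light_tree G y"
  by (auto simp: light_tree_def)

lemma light_walk_mono: "(u, v) \<in> (adj (light_tree G x))\<^sup>* \<Longrightarrow> x \<le> y \<Longrightarrow> (u, v) \<in> (adj (light_tree G y))\<^sup>*"
  using rtrancl_mono[OF adj_mono[OF light_tree_mono]] by blast

section \<open>Reading local views\<close>

lemma admissibleD:
  assumes "admissible c d G"
  shows "simple_graph (verts G) (edges G)" "connected_graph (verts G) (edges G)"
    "inj_on (ident G) (verts G)" "represented G \<subseteq> edges G"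
  using assms by (auto simp: admissible_def represented_def incident_def)

lemma edge_verts: "simple_graph V E \<Longrightarrow> {u, v} \<in> E \<Longrightarrow> u \<in> V \<and> v \<in> V \<and> u \<noteq> v"
  unfolding simple_graph_def by force

lemma ball_subset:
  assumes "simple_graph V E" "v \<in> V"
  shows "ball E r v \<subseteq> V"
proof
  fix u assume "u \<in> ball E r v"
  then obtain k where "(v, u) \<in> adj E ^^ k" by (auto simp: ball_def)
  then have "(v, u) \<in> (adj E)\<^sup>*" by (rule relpow_imp_rtrancl)
  then show "u \<in> V"
    using assms(2) edge_verts[OF assms(1)]
    by (induction rule: rtrancl_induct) (auto simp: adj_def)
qed

lemma ball_self: "v \<in> ball E r v"
  by (auto simp: ball_def intro!: exI[of _ 0])

lemma ball_neighbour: "{v, u} \<in> E \<Longrightarrow> 1 \<le> r \<Longrightarrow> u \<in> ball E r v"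
  by (auto simp: ball_def adj_def intro!: exI[of _ 1])

context
  fixes G :: config and c d :: real and r :: nat and cert :: "nat \<Rightarrow> certificate" and v :: nat
  assumes adm: "admissible c d G" and v: "v \<in> verts G"
begin

lemma ball_ident_eq: "u \<in> ball (edges G) r v \<Longrightarrow> u' \<in> ball (edges G) r v \<Longrightarrow> ident G u = ident G u' \<Longrightarrow> u = u'"
  using admissibleD[OF adm] ball_subset[OF _ v] by (meson inj_onD subsetD)

lemma view_info_local_view:
  assumes "u \<in> ball (edges G) r v"
  shows "view_info dec (local_view r G cert v) (ident G u) = dec (cert u)"
proof -
  have "(THE ct. \<exists>ms. (ident G u, ct, ms) \<in> v_nodes (local_view r G cert v)) = cert u"
  proof (rule the_equality)
    show "\<exists>ms. (ident G u, cert u, ms) \<in> v_nodes (local_view r G cert v)"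
      using assms by (auto simp: local_view_def)
    fix ct assume "\<exists>ms. (ident G u, ct, ms) \<in> v_nodes (local_view r G cert v)"
    then obtain u' where "u' \<in> ball (edges G) r v" "ident G u = ident G u'" "ct = cert u'"
      by (auto simp: local_view_def)
    then show "ct = cert u" using ball_ident_eq[OF assms] by simp
  qed
  then show ?thesis by (simp add: view_info_def)
qed

text \<open>Injectivity of identities on the ball turns edges between identities back into edges of
  the graph.\<close>

lemma view_edge_iff:
  assumes "u \<in> ball (edges G) r v"
  shows "({ident G u, b}, w, h) \<in> v_edges (local_view r G cert v) \<longleftrightarrow>
    (\<exists>u'\<in>ball (edges G) r v. {u, u'} \<in> edges G \<and> b = ident G u' \<and> w = wt G {u, u'} \<and> h = ({u, u'} \<in> represented G))"
    (is "?l \<longleftrightarrow> ?r")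
proof
  assume ?l
  then obtain e where e: "e \<in> edges G" "e \<subseteq> ball (edges G) r v" "ident G ` e = {ident G u, b}"
    "w = wt G e" "h = (e \<in> represented G)"
    by (auto simp: local_view_def)
  have "card e = 2" using admissibleD(1)[OF adm] e(1) by (auto simp: simple_graph_def)
  have "u \<in> e"
  proof -
    obtain x where "x \<in> e" "ident G x = ident G u" using e(3) by (metis imageE insertI1)
    then show ?thesis using ball_ident_eq[OF _ assms, of x] e(2) by auto
  qed
  then obtain u' where u': "e = {u, u'}" "u' \<noteq> u"
    using \<open>card e = 2\<close> by (auto simp: card_2_iff)
  moreover have "u' \<in> ball (edges G) r v" using e(2) u' by auto
  moreover have "ident G u' \<noteq> ident G u" using ball_ident_eq[OF \<open>u' \<in> ball (edges G) r v\<close> assms] u' by auto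
  then have "b = ident G u'" using e(3) u' by (auto simp: doubleton_eq_iff)
  ultimately show ?r using e by blast
next
  assume ?r
  then obtain u' where u': "u' \<in> ball (edges G) r v" "{u, u'} \<in> edges G" "b = ident G u'" "w = wt G {u, u'}"
    "h = ({u, u'} \<in> represented G)" by blast
  then show ?l unfolding local_view_def using assms
    by (auto intro!: image_eqI[of _ _ "{u, u'}"])
qed

lemma view_adj_iff:
  assumes "u \<in> ball (edges G) r v"
  shows "(ident G u, b) \<in> view_adj (local_view r G cert v) x \<longleftrightarrow> (\<exists>u'\<in>ball (edges G) r v. b = ident G u' \<and> {u, u'} \<in> light_tree G x)"
  using admissibleD(4)[OF adm] view_edge_iff[OF assms]
  by (auto simp: view_adj_def adj_def light_tree_def)

lemma view_walkD:
  assumes "(ident G u, b) \<in> (view_adj (local_view r G cert v) x)\<^sup>*" "u \<in> ball (edges G) r v"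
  obtains u' where "u' \<in> ball (edges G) r v" "b = ident G u'" "(u, u') \<in> (adj (light_tree G x))\<^sup>*"
proof -
  have "\<exists>u'\<in>ball (edges G) r v. b = ident G u' \<and> (u, u') \<in> (adj (light_tree G x))\<^sup>*"
    using assms(1)
  proof (induction rule: rtrancl_induct)
    case base
    then show ?case using assms(2) by blast
  next
    case (step y z)
    then obtain u1 where u1: "u1 \<in> ball (edges G) r v" "y = ident G u1" "(u, u1) \<in> (adj (light_tree G x))\<^sup>*" by blast
    then obtain u2 where "u2 \<in> ball (edges G) r v" "z = ident G u2" "{u1, u2} \<in> light_tree G x"
      using step(2) view_adj_iff by blast
    then show ?case using u1 by (auto simp: adj_iff intro!: bexI[of _ u2] rtrancl.rtrancl_into_rtrancl[of u u1])
  qed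
  then show thesis using that by blast
qed

lemma view_walkI:
  assumes "\<And>i. i < j \<Longrightarrow> (f i, f (Suc i)) \<in> adj (light_tree G x)" "\<And>i. i \<le> j \<Longrightarrow> f i \<in> ball (edges G) r v"
  shows "(ident G (f 0), ident G (f j)) \<in> (view_adj (local_view r G cert v) x)\<^sup>*"
proof (rule rtrancl_segment[where f = "\<lambda>i. ident G (f i)"])
  fix i assume "i < j"
  then show "(ident G (f i), ident G (f (Suc i))) \<in> view_adj (local_view r G cert v) x"
    using assms(1)[of i] assms(2)[of i] assms(2)[of "Suc i"] view_adj_iff[of "f i"] by (auto simp: adj_iff)
qed simp

end

section \<open>Soundness\<close>

text \<open>On a cycle, a node of greatest \<open>dep\<close> has two distinct neighbours that are
  not deeper.\<close>

lemma depth_acyclic: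
  fixes dep :: "nat \<Rightarrow> nat"
  assumes "\<And>v a b. {v, a} \<in> T \<Longrightarrow> {v, b} \<in> T \<Longrightarrow> dep a \<le> dep v \<Longrightarrow> dep b \<le> dep v \<Longrightarrow> a = b"
  shows "\<nexists>p. cycle T p"
proof
  assume "\<exists>p. cycle T p"
  then obtain p where p: "3 \<le> length p" "distinct p"
    "\<And>i. i < length p \<Longrightarrow> {p ! i, p ! (Suc i mod length p)} \<in> T"
    by (auto simp: cycle_def)
  let ?l = "length p"
  have "finite {..<?l}" "{..<?l} \<noteq> {}" using p(1) by (auto simp: lessThan_empty_iff)
  then obtain i where i: "i < ?l" "\<And>j. j < ?l \<Longrightarrow> dep (p ! j) \<le> dep (p ! i)"
    using arg_min_if_finite(1)[of "{..<?l}"] Max_in[of "(\<lambda>i. dep (p ! i)) ` {..<?l}"]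
      Max_ge[of "(\<lambda>i. dep (p ! i)) ` {..<?l}"]
    by (smt (verit) finite_imageI image_iff image_is_empty lessThan_iff)
  \<comment> \<open>The cyclic predecessor of \<open>i\<close>; it differs from the successor
    because the cycle has length at least 3.\<close>
  define j where "j = (if i = 0 then ?l - 1 else i - 1)"
  have j: "j < ?l" "Suc j mod ?l = i" "Suc i mod ?l \<noteq> j" "Suc i mod ?l < ?l"
    using i(1) p(1) by (auto simp: j_def mod_Suc)
  have "p ! (Suc i mod ?l) = p ! j"
    using p(3)[OF i(1)] p(3)[OF j(1)] i(2)[OF j(1)] i(2)[OF j(4)]
    by (intro assms[of "p ! i"]) (auto simp: j(2) insert_commute)
  then show False using p(2) j by (simp add: nth_eq_iff_index_eq)
qed

text \<open>The certificates are arbitrary here: nothing says that depths are distances, that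
  entries hold bottleneck weights, or that centres come from a ranking.\<close>

lemma mst_verifier_sound:
  assumes adm: "admissible c d G" and "1 \<le> r"
    and acc: "\<And>v. v \<in> verts G \<Longrightarrow> mst_verifier dec (local_view r G cert v)"
  shows "MST G"
proof -
  let ?V = "verts G" and ?E = "edges G" and ?T = "represented G"
  let ?I = "\<lambda>v. dec (cert v)"
  let ?dep = "\<lambda>v. fst (snd (?I v))"
  let ?ent = "\<lambda>v. entries (ident G v) (?I v)"
  note adm' = admissibleD[OF adm]
  note D = mst_verifierD[OF acc]
  have cen [simp]: "v_center (local_view r G cert v) = ident G v" for v
    by (simp add: local_view_def)
  have info: "view_info dec (local_view r G cert v) (ident G u) = ?I u"
    if "v \<in> ?V" "u \<in> ball ?E r v" for u v
    using view_info_local_view[OF adm that(1)] that(2) by blast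
  have edge: "({ident G v, ident G u}, wt G {v, u}, {v, u} \<in> ?T) \<in> v_edges (local_view r G cert v)"
    "u \<in> ball ?E r v" "v \<in> ?V" "u \<in> ?V"
    if "{v, u} \<in> ?E" for u v
    using edge_verts[OF adm'(1) that] ball_neighbour[OF that assms(2)] that
      view_edge_iff[OF adm, of v v r] ball_self by auto
  have root: "fst (?I u) = fst (?I v)" if "{v, u} \<in> ?E" for u v
    using D(1)[of v "ident G u"] edge[OF that] info[of v] ball_self[of v ?E r] by simp
  have root_all: "fst (?I u) = fst (?I v)" if "u \<in> ?V" "v \<in> ?V" for u v
  proof -
    have "(v, u) \<in> (adj ?E)\<^sup>*" using adm'(2) that by (auto simp: connected_graph_def)
    then show ?thesis by (induction rule: rtrancl_induct) (auto simp: adj_iff root)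
  qed
  have top: "fst (?I v) = ident G v" if "v \<in> ?V" "?dep v = 0" for v
    using D(2)[OF that(1)] info[OF that(1)] ball_self[of v ?E r] that(2) by simp
  have parent: "\<exists>u. {v, u} \<in> ?T \<and> ?dep u < ?dep v" if v: "v \<in> ?V" and pos: "0 < ?dep v" for v
  proof -
    obtain b w where bw: "({ident G v, b}, w, True) \<in> v_edges (local_view r G cert v)"
      "fst (snd (view_info dec (local_view r G cert v) b)) < ?dep v"
      using D(3)[OF v] info[OF v ball_self] pos by auto
    then obtain u where "u \<in> ball ?E r v" "{v, u} \<in> ?T" "b = ident G u"
      using view_edge_iff[OF adm v ball_self] by auto
    then show ?thesis using bw(2) info[OF v] by auto
  qed
  have unique: "a = b" if "{v, a} \<in> ?T" "{v, b} \<in> ?T" "?dep a \<le> ?dep v" "?dep b \<le> ?dep v" for v a b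
  proof -
    have E: "{v, a} \<in> ?E" "{v, b} \<in> ?E" using that adm'(4) by auto
    have "ident G a = ident G b"
      using D(4)[OF edge(3)[OF E(1)], of "ident G a" "wt G {v, a}" "ident G b" "wt G {v, b}"]
        edge(1)[OF E(1)] edge(1)[OF E(2)] that info[OF edge(3)[OF E(1)]] edge(2)[OF E(1)]
        edge(2)[OF E(2)] ball_self[of v ?E r] by simp
    then show ?thesis using adm'(3) edge(4) E by (auto dest: inj_onD)
  qed
  have conn: "connected_graph ?V ?T"
  proof -
    \<comment> \<open>Strictly decreasing depths end at depth 0, where the identity is the common
      root; injectivity makes that node unique.\<close>
    have up: "\<exists>z\<in>?V. ?dep z = 0 \<and> (v, z) \<in> (adj ?T)\<^sup>*" if "v \<in> ?V" for v
      using that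
    proof (induction "?dep v" arbitrary: v rule: less_induct)
      case less
      show ?case
      proof (cases "?dep v = 0")
        case False
        then obtain u where u: "{v, u} \<in> ?T" "?dep u < ?dep v" using parent less.prems by blast
        then have "u \<in> ?V" using edge(4) adm'(4) by blast
        then obtain z where "z \<in> ?V" "?dep z = 0" "(u, z) \<in> (adj ?T)\<^sup>*"
          using less.hyps[of u] u(2) by blast
        moreover have "(v, u) \<in> adj ?T" using u(1) by (simp add: adj_iff)
        ultimately show ?thesis by (blast intro: converse_rtrancl_into_rtrancl)
      qed (use less.prems in blast)
    qed
    show ?thesis unfolding connected_graph_def
    proof (intro ballI)
      fix u v assume uv: "u \<in> ?V" "v \<in> ?V"
      obtain y z where yz: "y \<in> ?V" "?dep y = 0" "(u, y) \<in> (adj ?T)\<^sup>*"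
        "z \<in> ?V" "?dep z = 0" "(v, z) \<in> (adj ?T)\<^sup>*"
        using up uv by metis
      then have "ident G y = ident G z" using top root_all by metis
      then have "y = z" using adm'(3) yz by (auto dest: inj_onD)
      then show "(u, v) \<in> (adj ?T)\<^sup>*"
        using yz(3) adj_rtrancl_sym[OF yz(6)] by (blast intro: rtrancl_trans)
    qed
  qed
  have acyclic: "\<nexists>p. cycle ?T p" using unique by (rule depth_acyclic)
  have tree: "spanning_tree ?V ?E ?T" using conn acyclic adm'(4) by (simp add: spanning_tree_def)
  have walkD: "\<exists>z\<in>ball ?E r v. b = ident G z \<and> (u, z) \<in> (adj (light_tree G x))\<^sup>*"
    if "v \<in> ?V" "u \<in> ball ?E r v" "(ident G u, b) \<in> (view_adj (local_view r G cert v) x)\<^sup>*" for u v b x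
    using view_walkD[OF adm that(1,3,2)] by blast
  have ballV: "u \<in> ?V" if "v \<in> ?V" "u \<in> ball ?E r v" for u v
    using ball_subset[OF adm'(1) that(1)] that(2) by blast
  \<comment> \<open>Each supporting entry is lexicographically smaller in \<open>(x, k)\<close>, so
    the chain of supports ends at a trivial entry, that is, at a node with identity
    \<open>c\<close>. In particular the named centre exists.\<close>
  have entry: "\<exists>z\<in>?V. ident G z = c \<and> (v, z) \<in> (adj (light_tree G x))\<^sup>*"
    if "v \<in> ?V" "(c, x, k) \<in> ?ent v" for v c x k
    using that
  proof (induction "(x, k)" arbitrary: v x k rule: wf_induct_rule[OF wf_lex_prod[OF wf_less_than wf_less_than]])
    case (1 x k v)
    show ?case
    proof (cases "(c, x, k) = (ident G v, 0, 0)")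
      case True
      then show ?thesis using 1(2) by auto
    next
      case False
      then have "(c, x, k) \<in> set (snd (snd (?I v)))" using 1(3) by (auto simp: entries_def)
      then obtain p y m where p: "(ident G v, p) \<in> (view_adj (local_view r G cert v) x)\<^sup>*"
        "(c, y, m) \<in> entries p (view_info dec (local_view r G cert v) p)" "y < x \<or> y = x \<and> m < k"
        using D(6)[OF 1(2), of c x k] info[OF 1(2) ball_self] False by auto
      obtain u where u: "u \<in> ball ?E r v" "p = ident G u" "(v, u) \<in> (adj (light_tree G x))\<^sup>*"
        using walkD[OF 1(2) ball_self p(1)] by blast
      have "(c, y, m) \<in> ?ent u" using p(2) u info[OF 1(2) u(1)] by simp
      then obtain z where z: "z \<in> ?V" "ident G z = c" "(u, z) \<in> (adj (light_tree G y))\<^sup>*"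
        using 1(1)[of y m u] p(3) ballV[OF 1(2) u(1)] by auto
      have "(u, z) \<in> (adj (light_tree G x))\<^sup>*" using light_walk_mono[OF z(3)] p(3) by auto
      with u(3) have "(v, z) \<in> (adj (light_tree G x))\<^sup>*" by (rule rtrancl_trans)
      then show ?thesis using z by blast
    qed
  qed
  \<comment> \<open>The two entries name the same identity, hence the same node, and their walks are
    light enough for the non-tree edge.\<close>
  have walk: "(u, v) \<in> (adj (light_tree G (wt G {u, v})))\<^sup>*" if e: "{u, v} \<in> ?E" "{u, v} \<notin> ?T" for u v
  proof -
    let ?w = "wt G {u, v}" and ?L = "local_view r G cert u"
    have u: "u \<in> ?V" using edge(3)[OF e(1)] .
    have "({ident G u, ident G v}, ?w, False) \<in> v_edges ?L" using edge(1)[OF e(1)] e(2) by simp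
    then obtain p q c x y k m where pq: "(ident G u, p) \<in> (view_adj ?L ?w)\<^sup>*"
      "(c, x, k) \<in> entries p (view_info dec ?L p)" "x \<le> ?w"
      "(ident G v, q) \<in> (view_adj ?L ?w)\<^sup>*"
      "(c, y, m) \<in> entries q (view_info dec ?L q)" "y \<le> ?w"
      using D(5)[OF u] unfolding cen by metis
    obtain p' where p': "p' \<in> ball ?E r u" "p = ident G p'" "(u, p') \<in> (adj (light_tree G ?w))\<^sup>*"
      using walkD[OF u ball_self pq(1)] by blast
    obtain q' where q': "q' \<in> ball ?E r u" "q = ident G q'" "(v, q') \<in> (adj (light_tree G ?w))\<^sup>*"
      using walkD[OF u edge(2)[OF e(1)] pq(4)] by blast
    have "(c, x, k) \<in> ?ent p'" "(c, y, m) \<in> ?ent q'"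
      using pq(2,5) p' q' info[OF u] by auto
    then obtain z z' where z: "z \<in> ?V" "ident G z = c" "(p', z) \<in> (adj (light_tree G x))\<^sup>*"
      "z' \<in> ?V" "ident G z' = c" "(q', z') \<in> (adj (light_tree G y))\<^sup>*"
      using entry ballV[OF u] p' q' by meson
    then have "z = z'" using adm'(3) by (auto dest: inj_onD)
    have "(u, z) \<in> (adj (light_tree G ?w))\<^sup>*" "(v, z) \<in> (adj (light_tree G ?w))\<^sup>*"
      using rtrancl_trans[OF p'(3) light_walk_mono[OF z(3) pq(3)]]
        rtrancl_trans[OF q'(3) light_walk_mono[OF z(6) pq(6)]] \<open>z = z'\<close> by auto
    then show ?thesis using adj_rtrancl_sym rtrancl_trans by metis
  qed
  show ?thesis unfolding MST_def
    using tree spanning_tree_minimal_if_walks[OF adm'(1) tree walk[unfolded light_tree_def]] by blast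
qed

section \<open>Completeness\<close>

text \<open>Depths of neighbours differ by at most one. They are not equal, since then
  \<open>u\<close> and the parent of \<open>v\<close> would be two neighbours of \<open>v\<close>
  that are not deeper.\<close>

lemma tree_depth_step:
  assumes "\<nexists>p. cycle T p" "\<And>v. v \<in> V \<Longrightarrow> (v, r) \<in> (adj T)\<^sup>*" "{u, v} \<in> T" "u \<in> V" "v \<in> V" "u \<noteq> v"
  defines "g \<equiv> \<lambda>v. walk_dist (adj T) v r"
  shows "g u = Suc (g v) \<or> g v = Suc (g u)"
proof -
  have le: "g a \<le> Suc (g b)" if "{a, b} \<in> T" "b \<in> V" for a b
  proof -
    have "(a, b) \<in> adj T" using that by (simp add: adj_iff)
    then have "(a, r) \<in> adj T ^^ Suc (g b)"
      using walk_dist_relpow[OF assms(2)[OF that(2)]] unfolding g_def by (rule relpow_Suc_I2)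
    then show ?thesis unfolding g_def by (rule walk_dist_le)
  qed
  have "g u \<noteq> g v"
  proof
    assume eq: "g u = g v"
    have "v \<noteq> r"
    proof
      assume "v = r"
      then have "g u = 0" using eq by (simp add: g_def)
      then show False using walk_dist_relpow[OF assms(2)[OF assms(4)]] \<open>v = r\<close> assms(6) by (simp add: g_def)
    qed
    then obtain w where w: "{v, w} \<in> T" "g v = Suc (g w)"
      unfolding g_def using tree_parent_exists[OF assms(2)[OF assms(5)]] by blast
    have "(w, v) \<in> adj T" using w(1) by (simp add: adj_iff insert_commute)
    then have "(w, r) \<in> (adj T)\<^sup>*"
      using assms(2)[OF assms(5)] by (rule converse_rtrancl_into_rtrancl)
    moreover have "{v, u} \<in> T" using assms(3) by (simp add: insert_commute)
    moreover have "w \<noteq> v" using w(2) by auto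
    ultimately have "u = w"
      using tree_parent_unique[OF assms(1), of v u w r] w assms(2)[OF assms(4)] assms(6) eq
      unfolding g_def by auto
    then show False using w eq by simp
  qed
  moreover have "g u \<le> Suc (g v)" "g v \<le> Suc (g u)"
    using le[of u v] le[of v u] assms by (auto simp: insert_commute)
  ultimately show ?thesis by linarith
qed

lemma card_residue_class:
  fixes K s q :: nat
  assumes "0 < s"
  shows "finite {l. l < K \<and> l mod s = q}" "card {l. l < K \<and> l mod s = q} \<le> K div s + 1"
proof -
  show fin: "finite {l. l < K \<and> l mod s = q}" by simp
  have "inj_on (\<lambda>l. l div s) {l. l < K \<and> l mod s = q}"
    by (rule inj_onI) (metis (mono_tags, lifting) mem_Collect_eq div_mult_mod_eq)
  moreover have "(\<lambda>l. l div s) ` {l. l < K \<and> l mod s = q} \<subseteq> {..K div s}"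
    by (auto simp: div_le_mono)
  ultimately have "card {l. l < K \<and> l mod s = q} \<le> card {..K div s}"
    by (intro card_inj_on_le) auto
  then show "card {l. l < K \<and> l mod s = q} \<le> K div s + 1" by simp
qed

text \<open>Speaks of decoded infos only: any decoder that returns \<open>I v\<close> is allowed, so
  the code can later be chosen from a mere count of infos. \<open>K\<close> bounds the levels and
  \<open>M\<close> all numbers that occur.\<close>

lemma mst_certificates_exist:
  assumes adm: "admissible c d G" and mst: "MST G" and r: "1 \<le> r"
    and K: "card (verts G) < 2 ^ K"
    and M: "\<And>e. e \<in> edges G \<Longrightarrow> wt G e \<le> M" "\<And>v. v \<in> verts G \<Longrightarrow> ident G v \<le> M" "card (verts G) \<le> M"
  defines "k \<equiv> K div ((r + 1) div 2) + 1"
  shows "\<exists>I. (\<forall>v\<in>verts G. I v \<in> {..M} \<times> {..M} \<times> {es. set es \<subseteq> {..M} \<times> {..M} \<times> {..M} \<and> length es \<le> k}) \<and>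
    (\<forall>dec cert. (\<forall>v\<in>verts G. dec (cert v) = I v) \<longrightarrow>
      (\<forall>v\<in>verts G. mst_verifier dec (local_view r G cert v)))"
proof -
  let ?V = "verts G" and ?E = "edges G" and ?T = "represented G"
  \<comment> \<open>The largest modulus with \<open>2 * s - 1 \<le> r\<close>.\<close>
  define s where "s = (r + 1) div 2"
  have s: "0 < s" "2 * s \<le> r + 1" using r by (auto simp: s_def)
  note adm' = admissibleD[OF adm]
  have finV: "finite ?V" and "?V \<noteq> {}" using adm'(1) by (auto simp: simple_graph_def)
  then obtain \<rho> where \<rho>: "\<rho> \<in> ?V" by blast
  have tree: "spanning_tree ?V ?E ?T"
    and min: "\<And>T'. spanning_tree ?V ?E T' \<Longrightarrow> sum (wt G) ?T \<le> sum (wt G) T'"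
    using mst by (auto simp: MST_def)
  have acyclic: "\<nexists>p. cycle ?T p" and conn: "connected_graph ?V ?T"
    using tree by (auto simp: spanning_tree_def)
  have edgeV: "u \<in> ?V" "v \<in> ?V" "u \<noteq> v" "{u, v} \<in> ?E" if "{u, v} \<in> ?T" for u v
  proof -
    show "{u, v} \<in> ?E" using adm'(4) that by (rule subsetD)
    then show "u \<in> ?V" "v \<in> ?V" "u \<noteq> v" using edge_verts[OF adm'(1)] by simp_all
  qed
  have reach: "(u, v) \<in> (adj ?T)\<^sup>*" if "u \<in> ?V" "v \<in> ?V" for u v
    using conn that by (auto simp: connected_graph_def)
  define \<delta> where "\<delta> v = walk_dist (adj ?T) v \<rho>" for v
  have adjV: "adj ?T \<subseteq> ?V \<times> ?V"
  proof (rule subrelI)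
    fix u v assume "(u, v) \<in> adj ?T"
    then have "{u, v} \<in> ?T" by (simp add: adj_iff)
    then show "(u, v) \<in> ?V \<times> ?V" using edgeV(1,2) by simp
  qed
  have \<delta>_step: "\<delta> u = Suc (\<delta> v) \<or> \<delta> v = Suc (\<delta> u)" if "{u, v} \<in> ?T" for u v
    unfolding \<delta>_def by (rule tree_depth_step[OF acyclic reach[OF _ \<rho>] that]) (use edgeV[OF that] in auto)
  have \<delta>_unique: "a = b" if "{v, a} \<in> ?T" "{v, b} \<in> ?T" "\<delta> a \<le> \<delta> v" "\<delta> b \<le> \<delta> v" for v a b
    using that(3,4) edgeV(3)[OF that(1)] edgeV(3)[OF that(2)] unfolding \<delta>_def
    by (intro tree_parent_unique[OF acyclic that(1,2) _ _ reach[OF edgeV(2)[OF that(1)] \<rho>]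
      reach[OF edgeV(2)[OF that(2)] \<rho>]]) auto
  have "\<forall>v\<in>?V. card (component ?T ?V v) < 2 ^ K"
    using card_mono[OF finV component_subset] K by (blast intro: le_less_trans)
  from vertex_ranking_exists[OF acyclic finV this]
  obtain l where l': "\<forall>v\<in>?V. l v < K"
    "\<forall>u\<in>?V. \<forall>v\<in>?V. l u = l v \<longrightarrow> (u, v) \<in> (adj_on ?T {y \<in> ?V. l y \<le> l u})\<^sup>* \<longrightarrow> u = v"
    by (elim exE conjE)
  have l: "\<And>v. v \<in> ?V \<Longrightarrow> l v < K"
    "\<And>u v. \<lbrakk>u \<in> ?V; v \<in> ?V; l u = l v; (u, v) \<in> (adj_on ?T {y \<in> ?V. l y \<le> l u})\<^sup>*\<rbrakk> \<Longrightarrow> u = v"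
    using l' by simp_all
  \<comment> \<open>The steps of a light walk towards the centre \<open>c\<close>: levels must not
    exceed that of \<open>c\<close>, which limits every node to one centre per level.\<close>
  define Q where "Q c x = adj_on (light_tree G x) {y \<in> ?V. l y \<le> l c}" for c x
  have Q_adj: "(u, v) \<in> adj (light_tree G x)" if "(u, v) \<in> Q c x" for u v c x
    using that by (auto simp: Q_def adj_on_def)
  have Q_T: "(u, v) \<in> adj ?T" "u \<in> ?V" "v \<in> ?V" if "(u, v) \<in> Q c x" for u v c x
    using that by (auto simp: Q_def adj_on_def adj_iff light_tree_def)
  have Q_ranked: "(u, v) \<in> (adj_on ?T {y \<in> ?V. l y \<le> l c})\<^sup>*" if "(u, v) \<in> (Q c x)\<^sup>*" for u v c x
    using that by (rule rtrancl_mono[THEN subsetD, rotated])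
      (auto simp: Q_def adj_on_def adj_iff light_tree_def)
  define C where "C v = {c \<in> ?V. \<exists>x. (v, c) \<in> (Q c x)\<^sup>*}" for v
  define X where "X c v = (LEAST x. (v, c) \<in> (Q c x)\<^sup>*)" for c v
  \<comment> \<open>Hops at the least bottleneck weight; they break the tie where \<open>X\<close>
    does not drop.\<close>
  define D where "D c v = walk_dist (Q c (X c v)) v c" for c v
  define ent where "ent c v = (ident G c, X c v, D c v)" for c v
  have X: "(v, c) \<in> (Q c (X c v))\<^sup>*" if "c \<in> C v" for c v
    using that unfolding C_def X_def by (auto intro: LeastI)
  have X_le: "X c v \<le> x" if "(v, c) \<in> (Q c x)\<^sup>*" for c v x
    using that unfolding X_def by (rule Least_le)
  have ent_self: "ent c c = (ident G c, 0, 0)" for c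
    using X_le[of c c 0] by (simp add: ent_def D_def)
  have X_bound: "X c v \<le> M" if "c \<in> C v" for c v
  proof -
    have "(v, c) \<in> (Q c M)\<^sup>*"
      using X[OF that] by (rule rtrancl_mono[THEN subsetD, rotated])
        (use M(1) adm'(4) in \<open>auto simp: Q_def adj_on_def adj_iff light_tree_def\<close>)
    then show ?thesis by (rule X_le)
  qed
  have D_bound: "D c v < card ?V" if "c \<in> C v" "v \<in> ?V" for c v
    unfolding D_def using X[OF that(1)] Q_T finV that(2) by (intro walk_dist_less_card) auto
  have \<delta>_bound: "\<delta> v < card ?V" if "v \<in> ?V" for v
    unfolding \<delta>_def using reach[OF that \<rho>] adjV finV that by (rule walk_dist_less_card)
  define S where "S v = {c \<in> C v. l c mod s = \<delta> v mod s}" for v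
  have finS: "finite (S v)" for v using finV by (auto simp: S_def C_def)
  \<comment> \<open>Two centres of \<open>v\<close> of equal level are joined through
    \<open>v\<close> without exceeding this level, so the ranking makes them equal.\<close>
  have inj: "inj_on l (C v)" for v
  proof (rule inj_onI)
    fix a b assume ab: "a \<in> C v" "b \<in> C v" "l a = l b"
    have "(v, b) \<in> (adj_on ?T {y \<in> ?V. l y \<le> l a})\<^sup>*"
      using Q_ranked[OF X[OF ab(2)]] ab(3) by simp
    with adj_on_rtrancl_sym[OF Q_ranked[OF X[OF ab(1)]]]
    have "(a, b) \<in> (adj_on ?T {y \<in> ?V. l y \<le> l a})\<^sup>*" by (rule rtrancl_trans)
    moreover have "a \<in> ?V" "b \<in> ?V" using ab(1,2) by (simp_all add: C_def)
    ultimately show "a = b" using l(2) ab(3) by blast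
  qed
  have card_S: "card (S v) \<le> k" for v
  proof -
    have "card (S v) \<le> card {i. i < K \<and> i mod s = \<delta> v mod s}"
      by (rule card_inj_on_le[of l])
        (use inj[of v] l(1) card_residue_class(1)[OF s(1)] in \<open>auto simp: S_def C_def inj_on_def\<close>)
    also have "\<dots> \<le> k" using card_residue_class(2)[OF s(1)] by (simp add: k_def s_def)
    finally show ?thesis .
  qed
  have "\<exists>es. set es = (\<lambda>c. ent c v) ` S v \<and> length es \<le> k" for v
  proof -
    obtain cs where "set cs = S v" "distinct cs" using finite_distinct_list[OF finS] by blast
    then show ?thesis
      using card_S[of v] by (intro exI[of _ "map (\<lambda>c. ent c v) cs"]) (simp flip: distinct_card)
  qed
  then obtain es where es: "\<And>v. set (es v) = (\<lambda>c. ent c v) ` S v" "\<And>v. length (es v) \<le> k" by metis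
  define I :: "nat \<Rightarrow> info" where "I v = (ident G \<rho>, \<delta> v, es v)" for v

  \<comment> \<open>\<open>a\<close> is the number of steps to be taken before any entry is
    considered: 0 to look an entry up, 1 to support an entry by a strictly smaller one.\<close>
  have find: "\<exists>f j. f 0 = v \<and> j \<le> a + 2 * s - 2 \<and>
      (\<forall>i<j. (f i, f (Suc i)) \<in> adj (light_tree G (X c v))) \<and>
      ent c (f j) \<in> entries (ident G (f j)) (I (f j)) \<and>
      X c (f j) \<le> X c v \<and> (a = 0 \<or> X c (f j) < X c v \<or> D c (f j) < D c v)"
    if v: "v \<in> ?V" and c: "c \<in> C v" and a: "a \<le> D c v" for v c a
  proof -
    define R where "R = Q c (X c v)"
    define m where "m = D c v"
    obtain f where "f 0 = v" "f (walk_dist R v c) = c"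
      "\<And>i. i < walk_dist R v c \<Longrightarrow> (f i, f (Suc i)) \<in> R"
      "\<And>i. i \<le> walk_dist R v c \<Longrightarrow> walk_dist R (f i) c = walk_dist R v c - i"
      "inj_on f {..walk_dist R v c}"
      using shortest_walk[of v c R] X[OF c] unfolding R_def by metis
    then have f: "f 0 = v" "f m = c" "\<And>i. i < m \<Longrightarrow> (f i, f (Suc i)) \<in> R"
      "\<And>i. i \<le> m \<Longrightarrow> walk_dist R (f i) c = m - i" "inj_on f {..m}"
      by (simp_all add: m_def D_def R_def)
    have fT: "{f i, f (Suc i)} \<in> ?T" if "i < m" for i
      using Q_T(1) f(3)[OF that] by (simp add: R_def adj_iff)
    obtain j where j: "a \<le> j" "j \<le> m" "j \<le> a + 2 * s - 2" "j = m \<or> \<delta> (f j) mod s = l c mod s"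
    proof (rule unimodal_residue[of m "\<lambda>i. \<delta> (f i)" s a "l c"])
      fix i assume "i < m"
      then show "\<delta> (f (Suc i)) = Suc (\<delta> (f i)) \<or> \<delta> (f i) = Suc (\<delta> (f (Suc i)))"
        using \<delta>_step[OF fT] by blast
    next
      \<comment> \<open>If the depth rose and then fell, both path neighbours of
        \<open>f (Suc i)\<close> would be no deeper than it, hence equal, against
        injectivity.\<close>
      fix i assume i: "Suc i < m" "\<delta> (f (Suc i)) = Suc (\<delta> (f i))"
      show "\<delta> (f (Suc (Suc i))) = Suc (\<delta> (f (Suc i)))"
      proof (rule ccontr)
        assume "\<not> ?thesis"
        then have "\<delta> (f (Suc (Suc i))) \<le> \<delta> (f (Suc i))" using \<delta>_step[OF fT[OF i(1)]] by auto
        then have "f i = f (Suc (Suc i))"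
          using \<delta>_unique[of "f (Suc i)" "f i" "f (Suc (Suc i))"] fT[of i] fT[OF i(1)] i
          by (auto simp: insert_commute)
        then show False using inj_onD[OF f(5)] i(1) by fastforce
      qed
    qed (use s(1) a m_def in auto)
    have "(f j, f m) \<in> R\<^sup>*" by (rule rtrancl_segment[where f = f]) (use f(3) j(2) in auto)
    then have fj: "(f j, c) \<in> (Q c (X c v))\<^sup>*" using f(2) by (simp add: R_def)
    have "c \<in> ?V" using c by (simp add: C_def)
    then have cj: "c \<in> C (f j)" using fj by (auto simp: C_def)
    have "ent c (f j) \<in> entries (ident G (f j)) (I (f j))"
    proof (cases "j = m")
      case True
      then show ?thesis using ent_self[of c] f(2) by (simp add: entries_def)
    next
      case False
      then have "c \<in> S (f j)" using cj j(4) by (simp add: S_def)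
      then show ?thesis by (simp add: entries_def I_def es)
    qed
    moreover have "X c (f j) \<le> X c v" using fj by (rule X_le)
    \<comment> \<open>While \<open>X\<close> is unchanged the relation \<open>Q\<close> is the same,
      so \<open>D\<close> has dropped by \<open>j\<close>, which is at least
      \<open>a\<close>.\<close>
    moreover have "a = 0 \<or> X c (f j) < X c v \<or> D c (f j) < D c v"
    proof (cases "a = 0 \<or> X c (f j) < X c v")
      case False
      then have "X c (f j) = X c v" using \<open>X c (f j) \<le> X c v\<close> by simp
      then have "D c (f j) = m - j" using f(4)[OF j(2)] by (simp add: D_def R_def)
      then show ?thesis using False j by (simp add: m_def)
    qed blast
    moreover have "(f i, f (Suc i)) \<in> adj (light_tree G (X c v))" if "i < j" for i
      using Q_adj f(3)[of i] that j(2) by (auto simp: R_def)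
    ultimately show ?thesis using f(1) j(3) by blast
  qed

  \<comment> \<open>\<open>n\<close> counts the steps from \<open>v\<close> to the start of the
    walk: 0 for \<open>v\<close> itself, 1 for the other end of a non-tree edge.\<close>
  have walk_ball: "\<And>i. i \<le> j \<Longrightarrow> f i \<in> ball ?E r v"
    if "(v, f 0) \<in> adj ?E ^^ n" "n + j \<le> r" "\<And>i. i < j \<Longrightarrow> (f i, f (Suc i)) \<in> adj (light_tree G x)"
    for v n f j x
  proof -
    fix i assume i: "i \<le> j"
    have "(f 0, f i) \<in> adj ?E ^^ (i - 0)"
    proof (rule relpow_segment[where f = f])
      fix i' assume "i' < i"
      then show "(f i', f (Suc i')) \<in> adj ?E"
        using that(3)[of i'] i adm'(4) by (auto simp: adj_iff light_tree_def)
    qed auto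
    then have "(v, f i) \<in> adj ?E ^^ (n + i)" using that(1) by (auto simp: relpow_add)
    then show "f i \<in> ball ?E r v" using that(2) i by (auto simp: ball_def intro!: exI[of _ "n + i"])
  qed

  \<comment> \<open>The common centre is a node of greatest level on the light path: seen from it,
    both halves stay at or below its level.\<close>
  have centre: "\<exists>c. c \<in> C u \<and> c \<in> C v \<and> X c u \<le> wt G {u, v} \<and> X c v \<le> wt G {u, v}"
    if e: "{u, v} \<in> ?E" "{u, v} \<notin> ?T" for u v
  proof -
    let ?R = "adj (light_tree G (wt G {u, v}))"
    have "(u, v) \<in> ?R\<^sup>*"
      unfolding light_tree_def by (rule minimal_spanning_tree_walk[OF adm'(1) tree min e])
    then obtain f where f: "f 0 = u" "f (walk_dist ?R u v) = v"
      "\<And>i. i < walk_dist ?R u v \<Longrightarrow> (f i, f (Suc i)) \<in> ?R"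
      using shortest_walk by metis
    define m where "m = walk_dist ?R u v"
    note f = f[folded m_def]
    have fV: "f i \<in> ?V" if "i \<le> m" for i
    proof (cases i)
      case 0
      then show ?thesis using f(1) edge_verts[OF adm'(1) e(1)] by simp
    next
      case (Suc n)
      then show ?thesis using f(3)[of n] that edgeV by (auto simp: adj_iff light_tree_def)
    qed
    have "Max ((\<lambda>i. l (f i)) ` {..m}) \<in> (\<lambda>i. l (f i)) ` {..m}" by (rule Max_in) auto
    then obtain i where "Max ((\<lambda>i. l (f i)) ` {..m}) = l (f i)" "i \<in> {..m}" by (rule imageE)
    then have i: "i \<le> m" "Max ((\<lambda>i. l (f i)) ` {..m}) = l (f i)" by simp_all
    have max: "l (f j) \<le> l (f i)" if "j \<le> m" for j
      unfolding i(2)[symmetric] using that by (intro Max_ge) auto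
    let ?c = "f i"
    have step: "(f j, f (Suc j)) \<in> Q ?c (wt G {u, v})" if "j < m" for j
      using f(3)[OF that] fV[of j] fV[of "Suc j"] max[of j] max[of "Suc j"] that
      by (auto simp: Q_def adj_on_def)
    have 1: "(f 0, ?c) \<in> (Q ?c (wt G {u, v}))\<^sup>*"
      by (rule rtrancl_segment[where f = f]) (use step i in auto)
    have 2: "(?c, f m) \<in> (Q ?c (wt G {u, v}))\<^sup>*"
      by (rule rtrancl_segment[where f = f]) (use step i in auto)
    then have "(f m, ?c) \<in> (Q ?c (wt G {u, v}))\<^sup>*"
      unfolding Q_def by (rule adj_on_rtrancl_sym)
    then show ?thesis using 1 X_le f(1,2) fV[OF i(1)] by (auto simp: C_def)
  qed

  have "mst_verifier dec (local_view r G cert v)"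
    if dec: "\<And>v. v \<in> ?V \<Longrightarrow> dec (cert v) = I v" and v: "v \<in> ?V" for dec cert v
  proof -
    let ?L = "local_view r G cert v" and ?B = "ball ?E r v"
    have cen: "v_center ?L = ident G v" by (simp add: local_view_def)
    have BV: "u \<in> ?V" if "u \<in> ?B" for u using ball_subset[OF adm'(1) v] that by blast
    have info: "view_info dec ?L (ident G u) = I u" if "u \<in> ?B" for u
      using view_info_local_view[OF adm v that] dec[OF BV[OF that]] by simp
    have vB: "v \<in> ?B" by (rule ball_self)
    note iff = view_edge_iff[OF adm v vB]
    have root: "fst (view_info dec ?L b) = fst (view_info dec ?L (ident G v))"
      if "({ident G v, b}, w, h) \<in> v_edges ?L" for b w h
      using that iff info vB by (auto simp: I_def)
    have top: "fst (I v) = ident G v" if "fst (snd (I v)) = 0"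
      using that walk_dist_relpow[OF reach[OF v \<rho>]] by (simp add: I_def \<delta>_def)
    have parent: "\<exists>b w. ({ident G v, b}, w, True) \<in> v_edges ?L \<and> fst (snd (view_info dec ?L b)) < fst (snd (I v))"
      if "0 < fst (snd (I v))"
    proof -
      have "v \<noteq> \<rho>" using that by (auto simp: I_def \<delta>_def)
      then obtain u where u: "{v, u} \<in> ?T" "\<delta> v = Suc (\<delta> u)"
        using tree_parent_exists[OF reach[OF v \<rho>]] unfolding \<delta>_def by metis
      have uB: "u \<in> ?B" using edgeV(4)[OF u(1)] r by (rule ball_neighbour)
      then have "({ident G v, ident G u}, wt G {v, u}, True) \<in> v_edges ?L"
        using iff u(1) edgeV(4)[OF u(1)] by auto
      then show ?thesis using info[OF uB] u(2) by (auto simp: I_def)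
    qed
    have unique: "b = b'" if nb: "({ident G v, b}, w, True) \<in> v_edges ?L" "({ident G v, b'}, w', True) \<in> v_edges ?L"
      "fst (snd (view_info dec ?L b)) \<le> fst (snd (I v))" "fst (snd (view_info dec ?L b')) \<le> fst (snd (I v))" for b b' w w'
    proof -
      obtain u u' where u: "u \<in> ?B" "{v, u} \<in> ?T" "b = ident G u" "u' \<in> ?B" "{v, u'} \<in> ?T" "b' = ident G u'"
        using nb(1,2) iff by auto
      then have "u = u'" using nb(3,4) info by (intro \<delta>_unique[of v u u']) (auto simp: I_def)
      then show ?thesis using u by simp
    qed
    have light: "\<exists>p q c x y k m.
       (ident G v, p) \<in> (view_adj ?L w)\<^sup>* \<and> (c, x, k) \<in> entries p (view_info dec ?L p) \<and> x \<le> w \<and>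
       (b, q) \<in> (view_adj ?L w)\<^sup>* \<and> (c, y, m) \<in> entries q (view_info dec ?L q) \<and> y \<le> w"
      if nontree: "({ident G v, b}, w, False) \<in> v_edges ?L" for b w
    proof -
      obtain u where u: "u \<in> ?B" "{v, u} \<in> ?E" "b = ident G u" "w = wt G {v, u}" "{v, u} \<notin> ?T"
        using nontree iff by auto
      obtain c where c: "c \<in> C v" "c \<in> C u" "X c v \<le> w" "X c u \<le> w"
        using centre[OF u(2,5)] u(4) by blast
      \<comment> \<open>\<open>z\<close> is either end of the edge. At most one step to
        \<open>z\<close> and \<open>2 * s - 2\<close> steps of search stay within
        \<open>r\<close>.\<close>
      have "\<exists>p x k. (ident G z, p) \<in> (view_adj ?L w)\<^sup>* \<and>
          (ident G c, x, k) \<in> entries p (view_info dec ?L p) \<and> x \<le> w"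
        if z: "z \<in> ?V" "c \<in> C z" "X c z \<le> w" "(v, z) \<in> adj ?E ^^ n" "n \<le> 1" for z n
      proof -
        obtain f j where f: "f 0 = z" "j \<le> 2 * s - 2"
          "\<And>i. i < j \<Longrightarrow> (f i, f (Suc i)) \<in> adj (light_tree G (X c z))"
          "ent c (f j) \<in> entries (ident G (f j)) (I (f j))" "X c (f j) \<le> X c z"
          using find[OF z(1,2), of 0] by auto
        have light: "(f i, f (Suc i)) \<in> adj (light_tree G w)" if "i < j" for i
          using f(3)[OF that] adj_mono[OF light_tree_mono[OF z(3)]] by blast
        have fB: "f i \<in> ?B" if "i \<le> j" for i
          using walk_ball[of v f n j, OF _ _ light that] f(1,2) z(4,5) s by auto
        have "(ident G (f 0), ident G (f j)) \<in> (view_adj ?L w)\<^sup>*"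
          by (rule view_walkI[OF adm v, where f = f]) (simp_all add: light fB)
        then show ?thesis using f(1,4,5) info[OF fB[of j]] z(3)
          by (intro exI[of _ "ident G (f j)"] exI[of _ "X c (f j)"] exI[of _ "D c (f j)"]) (auto simp: ent_def)
      qed
      note near = this
      have "(v, v) \<in> adj ?E ^^ 0" "(v, u) \<in> adj ?E ^^ 1" using u(2) by (auto simp: adj_iff)
      then show ?thesis
        using near[OF v c(1,3)] near[OF BV[OF u(1)] c(2,4)] u(3) by blast
    qed
    have progress: "(c, x, k) = (ident G v, 0, 0) \<or>
       (\<exists>p y m. (ident G v, p) \<in> (view_adj ?L x)\<^sup>* \<and> (c, y, m) \<in> entries p (view_info dec ?L p) \<and>
          (y < x \<or> y = x \<and> m < k))"
      if entry: "(c, x, k) \<in> set (snd (snd (I v)))" for c x k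
    proof -
      obtain c' where c': "c' \<in> C v" "(c, x, k) = ent c' v"
        using entry by (auto simp: I_def es S_def)
      show ?thesis
      proof (cases "D c' v = 0")
        case True
        then have "v = c'" using walk_dist_relpow[OF X[OF c'(1)]] by (simp add: D_def)
        then show ?thesis using c'(2) ent_self by simp
      next
        case False
        then obtain f j where f: "f 0 = v" "j \<le> 2 * s - 1"
          "\<And>i. i < j \<Longrightarrow> (f i, f (Suc i)) \<in> adj (light_tree G (X c' v))"
          "ent c' (f j) \<in> entries (ident G (f j)) (I (f j))"
          "X c' (f j) \<le> X c' v" "X c' (f j) < X c' v \<or> D c' (f j) < D c' v"
          using find[OF v c'(1), of 1] by auto
        have fB: "f i \<in> ?B" if "i \<le> j" for i
          using walk_ball[of v f 0 j, OF _ _ f(3) that] f(1,2) s by auto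
        have "(ident G (f 0), ident G (f j)) \<in> (view_adj ?L (X c' v))\<^sup>*"
          by (rule view_walkI[OF adm v, where f = f]) (simp_all add: f(3) fB)
        then show ?thesis using f(1,4,5,6) info[OF fB[of j]] c'(2)
          by (intro disjI2 exI[of _ "ident G (f j)"] exI[of _ "X c' (f j)"] exI[of _ "D c' (f j)"])
            (auto simp: ent_def)
      qed
    qed
    show ?thesis
      unfolding mst_verifier_def Let_def cen info[OF vB]
    proof (intro conjI allI impI)
      fix b w h assume "({ident G v, b}, w, h) \<in> v_edges ?L"
      then show "fst (view_info dec ?L b) = fst (I v)" using root info[OF vB] by simp
    next
      fix b b' w w'
      assume "({ident G v, b}, w, True) \<in> v_edges ?L" "({ident G v, b'}, w', True) \<in> v_edges ?L"
        "fst (snd (view_info dec ?L b)) \<le> fst (snd (I v))"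
        "fst (snd (view_info dec ?L b')) \<le> fst (snd (I v))"
      then show "b = b'" by (rule unique)
    qed (fact top parent light progress)+
  qed
  moreover have "I v \<in> {..M} \<times> {..M} \<times> {es. set es \<subseteq> {..M} \<times> {..M} \<times> {..M} \<and> length es \<le> k}"
    if "v \<in> ?V" for v
    using M(2)[OF \<rho>] \<delta>_bound[OF that] M(3) es(2)[of v] es(1)[of v] X_bound D_bound[OF _ that] M(2)
    by (fastforce simp: I_def ent_def S_def C_def)
  ultimately show ?thesis by (intro exI[of _ I] conjI ballI allI impI) simp_all
qed

section \<open>Certificate sizes\<close>

text \<open>
  The size is measured at one fixed \<open>n\<close>, so it suffices to count the certificates used on
  \<open>n\<close>-node instances: the code may favour them over all others.
\<close>

lemma short_code_exists:
  fixes A :: "'a::countable set"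
  assumes "finite A" "card A \<le> 2 ^ m"
  obtains enc :: "'a \<Rightarrow> bool list" where "inj enc" "\<And>y. y \<in> A \<Longrightarrow> length (enc y) \<le> Suc m"
proof -
  let ?W = "{xs :: bool list. set xs \<subseteq> UNIV \<and> length xs = m}"
  have "card ?W = 2 ^ m" using card_lists_length_eq[of "UNIV :: bool set" m] by simp
  moreover have "finite ?W" by (rule finite_lists_length_eq) simp
  ultimately obtain g where g: "g ` A \<subseteq> ?W" "inj_on g A"
    using card_le_inj[OF assms(1), of ?W] assms(2) by auto
  \<comment> \<open>The leading bit separates the short codes for \<open>A\<close> from unary codes
    of all other infos. The latter keep the code injective everywhere, as one verifier has to decode
    on instances of every size.\<close>
  define enc where "enc y = (if y \<in> A then True # g y else False # replicate (to_nat y) True)" for y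
  have "inj enc"
  proof (rule injI)
    fix x y assume "enc x = enc y"
    then show "x = y"
      using inj_onD[OF g(2)] by (auto simp: enc_def replicate_eq_replicate split: if_splits)
  qed
  moreover have "length (enc y) \<le> Suc m" if "y \<in> A" for y
    using that g(1) by (auto simp: enc_def)
  ultimately show thesis by (rule that)
qed

lemma finite_infos:
  fixes M k :: nat
  shows "finite ({..M} \<times> {..M} \<times> {es. set es \<subseteq> {..M} \<times> {..M} \<times> {..M} \<and> length es \<le> k})"
  by (intro finite_cartesian_product finite_lists_length_le) auto

text \<open>Root and depth take \<open>2 * b\<close> bits; a list over at most
  \<open>2 ^ (3 * b)\<close> triples takes \<open>3 * b * (k + 1)\<close>, where the extra
  \<open>3 * b\<close> pays for the sum over all lengths.\<close>

lemma card_infos_le: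
  fixes M k b :: nat
  assumes "M < 2 ^ b" "0 < b"
  shows "card ({..M} \<times> {..M} \<times> {es. set es \<subseteq> {..M} \<times> {..M} \<times> {..M} \<and> length es \<le> k})
    \<le> 2 ^ (b * (3 * k + 5))"
proof -
  let ?Q = "2 ^ (3 * b) :: nat"
  have Q: "2 \<le> ?Q" using assms(2) by (intro self_le_power[of 2 "3 * b", simplified]) auto
  have "card ({..M} \<times> {..M} \<times> {..M}) = Suc M * (Suc M * Suc M)" by (simp add: card_cartesian_product)
  also have "\<dots> \<le> 2 ^ b * (2 ^ b * 2 ^ b)" using assms(1) by (intro mult_le_mono) auto
  also have "\<dots> = ?Q" by (simp flip: power_add)
  finally have q: "card ({..M} \<times> {..M} \<times> {..M}) \<le> ?Q" .
  have geom: "(\<Sum>i\<le>k. ?Q ^ i) \<le> ?Q ^ Suc k"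
  proof (induction k)
    case 0
    then show ?case using Q by simp
  next
    case (Suc k)
    have "(\<Sum>i\<le>Suc k. ?Q ^ i) \<le> 2 * ?Q ^ Suc k" using Suc by simp
    also have "\<dots> \<le> ?Q * ?Q ^ Suc k" using Q by (rule mult_right_mono) simp
    finally show ?case by simp
  qed
  have "card {es. set es \<subseteq> {..M} \<times> {..M} \<times> {..M} \<and> length es \<le> k}
      = (\<Sum>i\<le>k. card ({..M} \<times> {..M} \<times> {..M}) ^ i)"
    by (rule card_lists_length_le) simp
  also have "\<dots> \<le> (\<Sum>i\<le>k. ?Q ^ i)" using q by (intro sum_mono power_mono) auto
  also note geom
  finally have "card {es. set es \<subseteq> {..M} \<times> {..M} \<times> {..M} \<and> length es \<le> k} \<le> ?Q ^ Suc k" .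
  then have "card ({..M} \<times> {..M} \<times> {es. set es \<subseteq> {..M} \<times> {..M} \<times> {..M} \<and> length es \<le> k})
      \<le> 2 ^ b * (2 ^ b * ?Q ^ Suc k)"
    unfolding card_cartesian_product using assms(1) by (intro mult_le_mono) auto
  also have "\<dots> = 2 ^ (b * (3 * k + 5))"
    by (simp add: algebra_simps flip: power_mult power_add)
  finally show ?thesis .
qed

section \<open>Numerical bounds\<close>

text \<open>Enough bits for weights, identities and \<open>n\<close>: the \<open>+ 1\<close> makes
  the power of two strictly larger than \<open>n powr max c d\<close>. With \<open>1 \<le> c\<close>
  it also serves as the number of ranking levels.\<close>

definition width :: "real \<Rightarrow> real \<Rightarrow> nat \<Rightarrow> nat" where
  "width c d n = nat \<lfloor>max c d * log 2 (real n)\<rfloor> + 1"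

lemma powr_less_width:
  assumes "1 \<le> n" "1 \<le> c" "x \<le> max c d"
  shows "real n powr x < 2 ^ width c d n"
proof -
  have "0 \<le> log 2 (real n)" using assms(1) by simp
  then have nonneg: "0 \<le> max c d * log 2 (real n)" using assms(2) by (intro mult_nonneg_nonneg) auto
  have "real n powr x \<le> real n powr max c d" using assms by (intro powr_mono) auto
  also have "\<dots> = 2 powr (max c d * log 2 (real n))"
    using powr_powr[of 2 "log 2 (real n)" "max c d"] assms(1) by (simp add: mult.commute)
  also have "\<dots> < 2 powr real (width c d n)"
    unfolding width_def using nonneg by (intro powr_less_mono) linarith+
  also have "\<dots> = 2 ^ width c d n" by (simp add: powr_realpow)
  finally show ?thesis .
qed

text \<open>The exponent of \<open>card_infos_le\<close> for lists of length
  \<open>b div ((r + 1) div 2) + 1\<close>, and one bit that marks the favoured codes.\<close>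

definition scheme_bound :: "real \<Rightarrow> real \<Rightarrow> nat \<Rightarrow> nat \<Rightarrow> nat" where
  "scheme_bound c d n r = (let b = width c d n in b * (3 * (b div ((r + 1) div 2) + 1) + 5) + 1)"

lemma size_pls_MST_le:
  fixes c d :: real
  assumes c: "1 \<le> c" and d: "1 \<le> d" and t: "\<And>n. 1 \<le> n \<Longrightarrow> 1 \<le> t n"
  shows "size_pls c d MST t N \<le> enat (scheme_bound c d N (t N))"
proof -
  define b where "b = width c d"
  define A where "A n = ({..2 ^ b n - 1} \<times> {..2 ^ b n - 1} \<times>
    {es. set es \<subseteq> {..2 ^ b n - 1} \<times> {..2 ^ b n - 1} \<times> {..2 ^ b n - 1} \<and>
      length es \<le> b n div ((t n + 1) div 2) + 1} :: info set)" for n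
  define m where "m = b N * (3 * (b N div ((t N + 1) div 2) + 1) + 5)"
  have fin: "finite (A N)" unfolding A_def by (rule finite_infos)
  have card: "card (A N) \<le> 2 ^ m"
    unfolding A_def m_def by (rule card_infos_le) (auto simp: b_def width_def)
  obtain enc :: "info \<Rightarrow> certificate" where
    enc: "inj enc" "\<And>y. y \<in> A N \<Longrightarrow> length (enc y) \<le> Suc m"
    using short_code_exists[OF fin card] by metis
  \<comment> \<open>Formulated for instances of every size, each with its own \<open>A\<close>,
    because a scheme has to be correct everywhere; only \<open>A N\<close> receives short
    codes.\<close>
  define good where "good G I \<longleftrightarrow> (\<forall>v\<in>verts G. I v \<in> A (card (verts G))) \<and>
    (\<forall>dec cert. (\<forall>v\<in>verts G. dec (cert v) = I v) \<longrightarrow>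
      (\<forall>v\<in>verts G. mst_verifier dec (local_view (t (card (verts G))) G cert v)))" for G I
  have ex: "\<exists>I. good G I" if G: "admissible c d G" "MST G" for G
  proof -
    let ?n = "card (verts G)"
    have n: "1 \<le> ?n"
      using admissibleD(1)[OF G(1)] by (simp add: simple_graph_def Suc_le_eq card_gt_0_iff)
    have less: "x \<le> 2 ^ b ?n - 1" if "real x \<le> real ?n powr y" "y \<le> max c d" for x y
    proof -
      have "real x < 2 ^ b ?n"
        using that(1) powr_less_width[OF n c that(2)] unfolding b_def by (rule le_less_trans)
      then have "x < 2 ^ b ?n" by simp
      then show ?thesis by simp
    qed
    have "?n \<le> 2 ^ b ?n - 1" using less[of ?n 1] n c by simp
    moreover have "wt G e \<le> 2 ^ b ?n - 1" if "e \<in> edges G" for e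
      using G(1) that by (intro less[of _ c]) (auto simp: admissible_def)
    moreover have "ident G v \<le> 2 ^ b ?n - 1" if "v \<in> verts G" for v
      using G(1) that by (intro less[of _ d]) (auto simp: admissible_def)
    moreover have "?n < 2 ^ b ?n"
      using \<open>?n \<le> 2 ^ b ?n - 1\<close> by (metis less_numeral_extra(1) order_le_less_trans diff_less pos2 zero_less_power)
    ultimately show ?thesis
      unfolding good_def A_def by (intro mst_certificates_exist[OF G t[OF n]])
  qed
  define prv :: prover where "prv G v = enc ((SOME I. good G I) v)" for G v
  \<comment> \<open>Strings outside the range of \<open>enc\<close> decode to something arbitrary,
    which is harmless because \<open>mst_verifier_sound\<close> holds for every decoder.\<close>
  define ver :: verifier where "ver r vw = mst_verifier (inv enc) vw" for r vw
  have good: "good G (SOME I. good G I)" if "admissible c d G" "MST G" for G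
    using ex[OF that] by (rule someI_ex)
  have "is_pls c d MST t (prv, ver)"
    unfolding is_pls_def
  proof (clarsimp, intro conjI impI allI)
    fix G assume G: "admissible c d G"
    {
      assume "MST G"
      then show "\<forall>v\<in>verts G. accepts t ver G (prv G) v"
        using good[OF G] enc(1) by (simp add: good_def accepts_def ver_def prv_def)
    }
    {
      fix cert
      assume "\<not> MST G"
      moreover have "1 \<le> t (card (verts G))"
        using admissibleD(1)[OF G] by (intro t) (simp add: simple_graph_def Suc_le_eq card_gt_0_iff)
      ultimately show "\<exists>v\<in>verts G. \<not> accepts t ver G cert v"
        using mst_verifier_sound[OF G] unfolding accepts_def ver_def Let_def by blast
    }
  qed
  then have "size_pls c d MST t N \<le> scheme_size c d MST (prv, ver) N"
    unfolding size_pls_def by (intro INF_lower) simp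
  also have "\<dots> \<le> enat (Suc m)"
    unfolding scheme_size_def
  proof (intro SUP_least)
    fix G v assume "G \<in> {G. admissible c d G \<and> MST G \<and> card (verts G) = N}" "v \<in> verts G"
    then show "enat (length (fst (prv, ver) G v)) \<le> enat (Suc m)"
      using good[of G] enc(2) by (auto simp: good_def prv_def)
  qed
  finally show ?thesis by (simp add: scheme_bound_def Let_def m_def b_def)
qed

text \<open>The modulus is at least \<open>r / 2\<close>, so the main part is at most
  \<open>6 * b^2 / r\<close>. The rest, \<open>8 * b + 1 \<le> 9 * b\<close>, fits the target only
  because of \<open>r \<le> C * ln n\<close>, which gives
  \<open>b \<le> B * C * (ln n)^2 / r\<close>. \<open>B\<close> absorbs the \<open>+ 1\<close> in
  \<open>width\<close>, as \<open>ln n\<close> is at least \<open>ln 2\<close>.\<close>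

lemma scheme_bound_le:
  fixes c d C :: real
  assumes c: "1 \<le> c" and n: "2 \<le> n" and r: "1 \<le> r" "real r \<le> C * ln (real n)"
  defines "B \<equiv> (max c d + 1) / ln 2"
  shows "real (scheme_bound c d n r) \<le> (6 * B\<^sup>2 + 9 * B * C) * ((ln (real n))\<^sup>2 / real r)"
proof -
  define b where "b = width c d n"
  define s where "s = (r + 1) div 2"
  let ?l = "ln (real n)"
  have l: "ln 2 \<le> ?l" "0 < ?l" using n by auto
  have "real b \<le> max c d * log 2 (real n) + 1"
    unfolding b_def width_def using c n by (auto simp: mult_nonneg_nonneg)
  also have "\<dots> \<le> max c d * (?l / ln 2) + ?l / ln 2" using l(1) by (simp add: log_def)
  also have "\<dots> = B * ?l" by (simp add: B_def field_simps)
  finally have b: "real b \<le> B * ?l" .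
  have b1: "1 \<le> real b" by (simp add: b_def width_def)
  have B: "0 < B" using c by (simp add: B_def)
  have "real r \<le> 2 * real s" unfolding s_def by linarith
  have s0: "0 < s" using r(1) by (simp add: s_def)
  have "real (b div s) \<le> real b / real s" by (rule of_nat_div_le_of_nat)
  also have "\<dots> \<le> real b / (real r / 2)"
    using \<open>real r \<le> 2 * real s\<close> r(1) by (intro divide_left_mono) (auto intro!: mult_pos_pos simp: s0)
  finally have q: "real (b div s) \<le> 2 * real b / real r" by (simp add: field_simps)
  have "real (scheme_bound c d n r) = real b * (3 * real (b div s) + 8) + 1"
    by (simp add: scheme_bound_def Let_def b_def s_def algebra_simps)
  also have "\<dots> \<le> real b * (3 * (2 * real b / real r) + 8) + real b"
    using q b1 by (intro add_mono mult_left_mono) auto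
  also have "\<dots> = 6 * (real b)\<^sup>2 / real r + 9 * real b"
    by (simp add: algebra_simps power2_eq_square)
  also have "\<dots> \<le> 6 * (B * ?l)\<^sup>2 / real r + 9 * (B * C * ?l\<^sup>2 / real r)"
  proof (intro add_mono mult_left_mono divide_right_mono power_mono)
    have "real b * real r \<le> (B * ?l) * (C * ?l)"
      using b r(2) B l(2) by (intro mult_mono) auto
    then show "real b \<le> B * C * ?l\<^sup>2 / real r"
      using r(1) by (simp add: pos_le_divide_eq power2_eq_square algebra_simps)
  qed (use b in auto)
  also have "\<dots> = (6 * B\<^sup>2 + 9 * B * C) * (?l\<^sup>2 / real r)"
    by (simp add: algebra_simps power2_eq_square add_divide_distrib)
  finally show ?thesis .
qed

text \<open>Finiteness is claimed separately because \<open>the_enat\<close> is unspecified at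
  infinity.\<close>

theorem theorem20:
  fixes c d :: real and t :: "nat \<Rightarrow> nat"
  assumes "1 \<le> c" and "1 \<le> d"
    and "\<And>n. 1 \<le> n \<Longrightarrow> 1 \<le> t n"
    and "(\<lambda>n. real (t n)) \<in> O(\<lambda>n. ln (real n))"
  shows "(\<forall>n. size_pls c d MST t n < \<infinity>) \<and>
    (\<lambda>n. real (the_enat (size_pls c d MST t n))) \<in> O(\<lambda>n. (ln (real n))\<^sup>2 / real (t n))"
proof (intro conjI allI)
  have le: "size_pls c d MST t n \<le> enat (scheme_bound c d n (t n))" for n
    using assms(1-3) by (rule size_pls_MST_le)
  show "size_pls c d MST t n < \<infinity>" for n
    using le[of n] by (rule le_less_trans) simp
  have the_le: "the_enat (size_pls c d MST t n) \<le> scheme_bound c d n (t n)" for n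
    using le[of n] by (cases "size_pls c d MST t n") auto
  obtain C where C: "\<forall>\<^sub>F n in sequentially. norm (real (t n)) \<le> C * norm (ln (real n))"
    using assms(4) by (rule landau_o.bigE)
  let ?B = "(max c d + 1) / ln 2"
  show "(\<lambda>n. real (the_enat (size_pls c d MST t n))) \<in> O(\<lambda>n. (ln (real n))\<^sup>2 / real (t n))"
  proof (rule bigoI)
    show "\<forall>\<^sub>F n in sequentially. norm (real (the_enat (size_pls c d MST t n)))
      \<le> (6 * ?B\<^sup>2 + 9 * ?B * C) * norm ((ln (real n))\<^sup>2 / real (t n))"
      \<comment> \<open>At \<open>n = 1\<close> the logarithm vanishes, so
        \<open>scheme_bound_le\<close> starts at 2.\<close>
      using C eventually_ge_at_top[of 2]
    proof eventually_elim
      case (elim n)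
      then have "real (t n) \<le> C * ln (real n)" by simp
      then have "real (scheme_bound c d n (t n)) \<le> (6 * ?B\<^sup>2 + 9 * ?B * C) * ((ln (real n))\<^sup>2 / real (t n))"
        using elim(2) assms(1,3) by (intro scheme_bound_le) auto
      then show ?case using the_le[of n] by simp
    qed
  qed
qed

end
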